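(* Let $\mathcal{E}$ and $\mathcal{F}$ be feasible and terminating bundle event structures with internal probability over a finite state space $\Omega$. If $\mathcal{E}\sqsubseteq_{\mathrm{sim}}\mathcal{F}$ then $\mathcal{E}\sqsubseteq\mathcal{F}$, i.e. $[\![\mathcal{E}]\!](s)\subseteq[\![\mathcal{F}]\!](s)$ for every $s\in\Omega$.
   Context: **Programs.** $\Omega$ is a fixed finite set of states. $\mathbb{D}\Omega$ is the set of distributions on $\Omega$, viewed inside $\mathbb{R}^\Omega$; $\mathbb{D}_{\le 1}\Omega$ is the set of subdistributions; $\delta_s$ is the point distribution at $s$. $\mathbb{H}_1\Omega$ is the set of maps $r:\Omega\to\mathcal{P}(\mathbb{D}\Omega)$ such that each $r(s)$ is non-empty, convex and topologically closed. A test is a map $b:\Omega\to\mathcal{P}(\mathbb{D}\Omega)$ with $b(s)\subseteq\{\delta_s\}$. $\overline{\mathbb{H}}_1\Omega$ is $\mathbb{H}_1\Omega$ together with all tests, ordered by $r\sqsubseteq_{\mathbb{H}}r'$ iff $r(s)\subseteq r'(s)$ for all $s$. $\delta$ denotes the program $\delta(s)=\{\delta_s\}$. **ipBES.** A bundle event structure with internal probability (ipBES) is $\mathcal{E}=(E,\mapsto,\#,\lambda,\mathbf{\Phi})$ where $E$ is a set of events; $\#$ is an irreflexive symmetric relation on $E$; for $x,x'\subseteq E$, $x\#x'$ means $e\#e'$ for all $e\in x,e'\in x'$ with $e\ne e'$; $\mapsto\subseteq\mathcal{P}(E)\times E$ satisfies $x\#x$ whenever $x\mapsto e$; $\lambda:E\to\overline{\mathbb{H}}_1\Omega$;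 $\mathbf{\Phi}\subseteq\mathcal{P}(E)$ with $x\#x$ for $x\in\mathbf{\Phi}$. **Traces.** A finite trace is a finite sequence $e_1\cdots e_n$ of distinct, pairwise non-conflicting events such that for every $j$ and every bundle $x\mapsto e_j$ there is $i<j$ with $e_i\in x$. $\mathcal{T}(\mathcal{E})$ is the set of finite traces (empty trace $\emptyset$), $\mathcal{T}_{\max}(\mathcal{E})$ the set of prefix-maximal ones. A trace $\alpha$ is weakly maximal if it is maximal or there are events $e_1,\dots,e_n$ with $\alpha e_1\cdots e_n\in\mathcal{T}_{\max}(\mathcal{E})$ and $\delta\sqsubseteq_{\mathbb{H}}\lambda(e_i)$ for all $i$. **Schedulers and semantics.** A scheduler $\sigma$ on $\mathcal{E}$ assigns to each $\alpha\in\mathcal{T}(\mathcal{E})$ a partial function $\sigma(\alpha):E\times\Omega\rightharpoonup\mathbb{D}_{\le1}\Omega$ with domain $\{(e,s):\alpha e\in\mathcal{T}(\mathcal{E}),\,s\in\Omega\}$ for which there is $w:E\times\Omega\to[0,1]$ (depending on $\alpha$) such that for $(e,s)$ in the domain: if $\lambda(e)(s)\neq\emptyset$ then $\sigma(\alpha)(e,s)=w(e,s)\mu$ for some $\mu\in\lambda(e)(s)$; if $\lambda(e)(s)=\emptyset$ then $w(e,s)=0$ and $\sigma(\alpha)(e,s)=0$; and, when the domain is non-empty, $\sum_{e:\alpha e\in\mathcal{T}(\mathcal{E})}w(e,s)=1$ for every $s$. From initial state $s$, define $\varphi_s(\emptyset)=\delta_s$, $\varphi_s(\alpha e)(u)=\sum_{t\in\Omega}\sigma(\alpha)(e,t)(u)\varphi_s(\alpha)(t)$,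 and $\sigma_s(\mathcal{E})=\sum_{\alpha\in\mathcal{T}_{\max}(\mathcal{E})}\varphi_s(\alpha)$. $\mathbf{Sched}_1(\mathcal{E})$ is the set of schedulers $\sigma$ such that $\sigma_s(\mathcal{E})$ is a distribution for every $s$. $\mathcal{E}$ is feasible if for every $\alpha\in\mathcal{T}(\mathcal{E})\setminus\mathcal{T}_{\max}(\mathcal{E})$, $\bigcup_{\alpha e\in\mathcal{T}(\mathcal{E})}\{s:\lambda(e)(s)\ne\emptyset\}=\Omega$; it is terminating if $\mathbf{Sched}_1(\mathcal{E})\neq\emptyset$. $[\![\mathcal{E}]\!](s)$ is the topological closure of the convex hull of $\{\sigma_s(\mathcal{E}):\sigma\in\mathbf{Sched}_1(\mathcal{E})\}$. For feasible $\mathcal{E},\mathcal{F}$, $\mathcal{E}\sqsubseteq\mathcal{F}$ means $[\![\mathcal{E}]\!]\sqsubseteq_{\mathbb{H}}[\![\mathcal{F}]\!]$. **t-simulation.** A function $f:\mathcal{T}(\mathcal{E})\to\mathcal{T}(\mathcal{F})$ is a t-simulation if: (i) $f(\emptyset)=\emptyset$ and $f^{-1}(\beta)$ is finite for every $\beta\in\mathcal{T}(\mathcal{F})$; (ii) if $\alpha e\in\mathcal{T}(\mathcal{E})$ then either $f(\alpha e)=f(\alpha)$ and $\lambda(e)\sqsubseteq_{\mathbb{H}}\delta$, or there is an event $e'$ of $\mathcal{F}$ with $\lambda(e)\sqsubseteq_{\mathbb{H}}\lambda(e')$ and $f(\alpha e)=f(\alpha)e'$; (iii) if $\alpha e$ is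 maximal in $\mathcal{T}(\mathcal{E})$ then $f(\alpha e)=f(\alpha)e'$ for some $e'$ with $\lambda(e)\sqsubseteq_{\mathbb{H}}\lambda(e')$, and $f(\alpha e)$ is weakly maximal in $\mathcal{T}(\mathcal{F})$. $\mathcal{E}\sqsubseteq_{\mathrm{sim}}\mathcal{F}$ means there is a t-simulation from $\mathcal{E}$ to $\mathcal{F}$.
   Formalization: Added hypothesis: if the empty trace is maximal in E, then it is weakly maximal in F. Without it the claim fails: an E with no events is t-simulated by every F, though its semantics is {δ_s}, which F's semantics need not contain. *)

theory Defs
  imports "HOL-Analysis.Analysis" "HOL-Library.Sublist"
begin

text \<open>The finite state space is a type \<open>'s\<close> of class \<^class>\<open>finite\<close>; distributions are vectors
  in \<open>real ^ 's\<close>, so that convexity, hull and closure are those of Euclidean space.\<close>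

definition dists :: "(real ^ 's::finite) set" where
  "dists = {\<mu>. (\<forall>s. 0 \<le> \<mu> $ s) \<and> (\<Sum>s\<in>UNIV. \<mu> $ s) = 1}"

definition subdists :: "(real ^ 's::finite) set" where
  "subdists = {\<mu>. (\<forall>s. 0 \<le> \<mu> $ s) \<and> (\<Sum>s\<in>UNIV. \<mu> $ s) \<le> 1}"

definition point_dist :: "'s::finite \<Rightarrow> real ^ 's" where
  "point_dist s = axis s 1"

type_synonym 's prog = "'s \<Rightarrow> (real ^ 's) set"

definition progs :: "'s::finite prog set" where
  "progs = {r. \<forall>s. r s \<subseteq> dists \<and> r s \<noteq> {} \<and> convex (r s) \<and> closed (r s)}"

definition tests :: "'s::finite prog set" where
  "tests = {b. \<forall>s. b s \<subseteq> {point_dist s}}"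

definition prog_le :: "'s::finite prog \<Rightarrow> 's prog \<Rightarrow> bool"  (infix "\<sqsubseteq>\<^sub>H" 50) where
  "r \<sqsubseteq>\<^sub>H r' \<longleftrightarrow> (\<forall>s. r s \<subseteq> r' s)"

definition skip :: "'s::finite prog" where
  "skip s = {point_dist s}"


record ('e, 's::finite) ipbes =
  events :: "'e set"
  bundles :: "('e set \<times> 'e) set"
  conflict :: "('e \<times> 'e) set"
  label :: "'e \<Rightarrow> 's prog"
  final :: "'e set set"

definition conflicting :: "('e, 's::finite) ipbes \<Rightarrow> 'e set \<Rightarrow> 'e set \<Rightarrow> bool" where
  "conflicting X x x' \<longleftrightarrow> (\<forall>e\<in>x. \<forall>e'\<in>x'. e \<noteq> e' \<longrightarrow> (e, e') \<in> conflict X)"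

definition is_ipbes :: "('e, 's::finite) ipbes \<Rightarrow> bool" where
  "is_ipbes X \<longleftrightarrow>
     conflict X \<subseteq> events X \<times> events X \<and> irrefl (conflict X) \<and> sym (conflict X) \<and>
     bundles X \<subseteq> Pow (events X) \<times> events X \<and> (\<forall>(x, e)\<in>bundles X. conflicting X x x) \<and>
     (\<forall>e\<in>events X. label X e \<in> progs \<union> tests) \<and>
     final X \<subseteq> Pow (events X) \<and> (\<forall>x\<in>final X. conflicting X x x)"


definition traces :: "('e, 's::finite) ipbes \<Rightarrow> 'e list set" where
  "traces X = {\<alpha>. set \<alpha> \<subseteq> events X \<and> distinct \<alpha> \<and>
     (\<forall>e\<in>set \<alpha>. \<forall>e'\<in>set \<alpha>. (e, e') \<notin> conflict X) \<and>
     (\<forall>j<length \<alpha>. \<forall>x. (x, \<alpha> ! j) \<in> bundles X \<longrightarrow> (\<exists>i<j. \<alpha> ! i \<in> x))}"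

definition max_traces :: "('e, 's::finite) ipbes \<Rightarrow> 'e list set" where
  "max_traces X = {\<alpha> \<in> traces X. \<forall>\<beta>\<in>traces X. prefix \<alpha> \<beta> \<longrightarrow> \<beta> = \<alpha>}"

definition weakly_maximal :: "('e, 's::finite) ipbes \<Rightarrow> 'e list \<Rightarrow> bool" where
  "weakly_maximal X \<alpha> \<longleftrightarrow> \<alpha> \<in> traces X \<and>
     (\<alpha> \<in> max_traces X \<or>
      (\<exists>es. \<alpha> @ es \<in> max_traces X \<and> (\<forall>e\<in>set es. skip \<sqsubseteq>\<^sub>H label X e)))"


type_synonym ('e, 's) sched = "'e list \<Rightarrow> ('e \<times> 's \<rightharpoonup> real ^ 's)"

definition scheduler :: "('e, 's::finite) ipbes \<Rightarrow> ('e, 's) sched \<Rightarrow> bool" where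
  "scheduler X \<sigma> \<longleftrightarrow> (\<forall>\<alpha>\<in>traces X.
     dom (\<sigma> \<alpha>) = {(e, s). \<alpha> @ [e] \<in> traces X} \<and>
     ran (\<sigma> \<alpha>) \<subseteq> subdists \<and>
     (\<exists>w :: 'e \<times> 's \<Rightarrow> real.
        (\<forall>e\<in>events X. \<forall>s. 0 \<le> w (e, s) \<and> w (e, s) \<le> 1) \<and>
        (\<forall>(e, s)\<in>dom (\<sigma> \<alpha>).
           (label X e s \<noteq> {} \<longrightarrow> (\<exists>\<mu>\<in>label X e s. \<sigma> \<alpha> (e, s) = Some (w (e, s) *\<^sub>R \<mu>))) \<and>
           (label X e s = {} \<longrightarrow> w (e, s) = 0 \<and> \<sigma> \<alpha> (e, s) = Some 0)) \<and>
        (dom (\<sigma> \<alpha>) \<noteq> {} \<longrightarrow>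
           (\<forall>s. ((\<lambda>e. w (e, s)) has_sum 1) {e. \<alpha> @ [e] \<in> traces X}))))"

text \<open>\<open>reach \<sigma> s \<alpha>\<close> is the subdistribution of states after running along \<open>\<alpha>\<close> from \<open>s\<close>.\<close>

function reach :: "('e, 's::finite) sched \<Rightarrow> 's \<Rightarrow> 'e list \<Rightarrow> real ^ 's" where
  "reach \<sigma> s [] = point_dist s"
| "reach \<sigma> s (\<alpha> @ [e]) = (\<chi> u. \<Sum>t\<in>UNIV. the (\<sigma> \<alpha> (e, t)) $ u * reach \<sigma> s \<alpha> $ t)"
  by (auto, metis rev_exhaust)
termination
  by (relation "Wellfounded.measure (\<lambda>(\<sigma>, s, \<alpha>). length \<alpha>)") auto

text \<open>The event set may be infinite, so the sum over maximal traces is an unordered infinite sum.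
  For a scheduler it always converges: the terms are non-negative and of total mass at most 1.\<close>

definition outcome :: "('e, 's::finite) ipbes \<Rightarrow> ('e, 's) sched \<Rightarrow> 's \<Rightarrow> real ^ 's" where
  "outcome X \<sigma> s = infsum (reach \<sigma> s) (max_traces X)"

definition sched1 :: "('e, 's::finite) ipbes \<Rightarrow> ('e, 's) sched set" where
  "sched1 X = {\<sigma>. scheduler X \<sigma> \<and> (\<forall>s. outcome X \<sigma> s \<in> dists)}"

definition feasible :: "('e, 's::finite) ipbes \<Rightarrow> bool" where
  "feasible X \<longleftrightarrow> (\<forall>\<alpha>\<in>traces X - max_traces X.
     (\<Union>e\<in>{e. \<alpha> @ [e] \<in> traces X}. {s. label X e s \<noteq> {}}) = UNIV)"

definition terminating :: "('e, 's::finite) ipbes \<Rightarrow> bool" where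
  "terminating X \<longleftrightarrow> sched1 X \<noteq> {}"

definition semantics :: "('e, 's::finite) ipbes \<Rightarrow> 's prog" where
  "semantics X s = closure (convex hull ((\<lambda>\<sigma>. outcome X \<sigma> s) ` sched1 X))"

definition ipbes_le :: "('e, 's::finite) ipbes \<Rightarrow> ('f, 's) ipbes \<Rightarrow> bool"  (infix "\<sqsubseteq>" 50) where
  "X \<sqsubseteq> Y \<longleftrightarrow> semantics X \<sqsubseteq>\<^sub>H semantics Y"


definition t_simulation ::
  "('e, 's::finite) ipbes \<Rightarrow> ('f, 's) ipbes \<Rightarrow> ('e list \<Rightarrow> 'f list) \<Rightarrow> bool" where
  "t_simulation X Y f \<longleftrightarrow>
     f \<in> traces X \<rightarrow> traces Y \<and>
     f [] = [] \<and>
     (\<forall>\<beta>\<in>traces Y. finite {\<alpha> \<in> traces X. f \<alpha> = \<beta>}) \<and>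
     (\<forall>\<alpha> e. \<alpha> @ [e] \<in> traces X \<longrightarrow>
        f (\<alpha> @ [e]) = f \<alpha> \<and> label X e \<sqsubseteq>\<^sub>H skip \<or>
        (\<exists>e'\<in>events Y. label X e \<sqsubseteq>\<^sub>H label Y e' \<and> f (\<alpha> @ [e]) = f \<alpha> @ [e'])) \<and>
     (\<forall>\<alpha> e. \<alpha> @ [e] \<in> max_traces X \<longrightarrow>
        (\<exists>e'\<in>events Y. label X e \<sqsubseteq>\<^sub>H label Y e' \<and> f (\<alpha> @ [e]) = f \<alpha> @ [e']) \<and>
        weakly_maximal Y (f (\<alpha> @ [e])))"

definition sim_le :: "('e, 's::finite) ipbes \<Rightarrow> ('f, 's) ipbes \<Rightarrow> bool"  (infix "\<sqsubseteq>\<^sub>s\<^sub>i\<^sub>m" 50) where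
  "X \<sqsubseteq>\<^sub>s\<^sub>i\<^sub>m Y \<longleftrightarrow> (\<exists>f. t_simulation X Y f)"

text \<open>The last clause of \<^const>\<open>t_simulation\<close> speaks only about traces of the form
  \<open>\<alpha> @ [e]\<close>, so it is void if \<open>X\<close> has no trace but the empty one. Such an \<open>X\<close> denotes
  \<^const>\<open>skip\<close>, yet it is simulated by every \<open>Y\<close>; hence \<open>\<sqsubseteq>\<^sub>s\<^sub>i\<^sub>m\<close> implies \<open>\<sqsubseteq>\<close> only together with
  the same clause read at the empty trace: if \<open>[]\<close> is maximal in \<open>X\<close>, it is weakly maximal in \<open>Y\<close>.\<close>

end

theory Submission imports Defs begin

text \<open>Give every initial state \<open>s\<close> a positive weight \<open>\<iota> s\<close> and run a scheduler of \<open>\<E>\<close> from this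
  initial vector. The resulting flow of mass on the trace tree of \<open>\<E>\<close> is pushed forward along the
  simulation to a flow on the trace tree of \<open>\<F>\<close>; conditioning on the current trace and state turns
  that flow into a scheduler of \<open>\<F>\<close> with the same \<open>\<iota>\<close>-weighted outcome. Total mass is at most 1 from
  each initial state, and all weights are positive, so this scheduler terminates from every state.
  The conditioning depends on \<open>\<iota>\<close>, so the outcome from a single state \<open>s\<close> is not reproduced exactly;
  but with weight 1 at \<open>s\<close> and \<open>\<delta>\<close> elsewhere the error is \<open>O(\<delta>)\<close>, which the closure in the
  definition of the semantics absorbs.\<close>

section \<open>Infinite sums and convex combinations\<close>

text \<open>Pairing each \<open>a\<close> with \<open>h a\<close> makes \<open>A\<close> a disjoint
  union of fibres, and an unordered sum over such a union may be taken fibre by fibre. Finiteness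
  makes the inner sums ordinary ones; for the simulation it comes from its clause on finite
  preimages.\<close>

lemma has_sum_fibres:
  fixes f :: "'a \<Rightarrow> 'v::real_normed_vector"
  assumes "(f has_sum S) A" and "\<And>a. a \<in> A \<Longrightarrow> h a \<in> B"
    and "\<And>b. b \<in> B \<Longrightarrow> finite {a \<in> A. h a = b}"
  shows "((\<lambda>b. \<Sum>a | a \<in> A \<and> h a = b. f a) has_sum S) B"
proof -
  have "(f has_sum S) A \<longleftrightarrow> ((\<lambda>(b, a). f a) has_sum S) (SIGMA b:B. {a \<in> A. h a = b})"
    by (rule has_sum_reindex_bij_witness[where i = snd and j = "\<lambda>a. (h a, a)"]) (use assms(2) in auto)
  with assms(1) have "((\<lambda>(b, a). f a) has_sum S) (SIGMA b:B. {a \<in> A. h a = b})"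
    by blast
  then show ?thesis
    by (rule has_sum_SigmaD) (use assms(3) in \<open>auto intro!: has_sum_finiteI\<close>)
qed

text \<open>Dividing by the total weight yields a convex combination. The alternative of weight zero
  lets \<open>C\<close> be empty, as the label of a test may be; if the total weight vanishes, so
  does every term and \<open>y\<close> is arbitrary.\<close>

lemma sum_scaleR_eq_convex_scaleR:
  fixes x :: "'i \<Rightarrow> 'v::real_vector"
  assumes "finite I" and "convex C"
    and w: "\<And>i. i \<in> I \<Longrightarrow> 0 \<le> w i" and x: "\<And>i. i \<in> I \<Longrightarrow> x i \<in> C \<or> w i = 0"
  shows "\<exists>y. (y \<in> C \<or> sum w I = 0) \<and> (\<Sum>i\<in>I. w i *\<^sub>R x i) = sum w I *\<^sub>R y"
proof (cases "sum w I = 0")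
  case True
  then have "\<forall>i\<in>I. w i = 0"
    using sum_nonneg_eq_0_iff[OF \<open>finite I\<close>] w by auto
  then show ?thesis
    by auto
next
  case False
  define J where "J = {i \<in> I. w i \<noteq> 0}"
  have J: "sum w J = sum w I" "(\<Sum>i\<in>J. w i *\<^sub>R x i) = (\<Sum>i\<in>I. w i *\<^sub>R x i)"
    unfolding J_def using \<open>finite I\<close> by (auto intro!: sum.mono_neutral_left)
  define y where "y = (\<Sum>i\<in>J. (w i / sum w I) *\<^sub>R x i)"
  have "0 < sum w I"
    using False sum_nonneg[of I w] w by force
  then have "y \<in> C"
    unfolding y_def using \<open>finite I\<close> \<open>convex C\<close> w x J(1)
    by (intro convex_sum) (auto simp: J_def simp flip: sum_divide_distrib)
  moreover have "(\<Sum>i\<in>I. w i *\<^sub>R x i) = sum w I *\<^sub>R y"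
    unfolding y_def J(2)[symmetric] scaleR_sum_right using False by simp
  ultimately show ?thesis
    by blast
qed

section \<open>Traces and schedulers\<close>

lemma Nil_in_traces: "[] \<in> traces X"
  by (simp add: traces_def)

lemma traces_appendD:
  assumes "\<alpha> @ \<beta> \<in> traces X"
  shows "\<alpha> \<in> traces X"
proof -
  have "\<exists>i<j. \<alpha> ! i \<in> x" if j: "j < length \<alpha>" and x: "(x, \<alpha> ! j) \<in> bundles X" for j x
  proof -
    have "j < length (\<alpha> @ \<beta>)" "(x, (\<alpha> @ \<beta>) ! j) \<in> bundles X"
      using j x by (auto simp: nth_append)
    then obtain i where "i < j" "(\<alpha> @ \<beta>) ! i \<in> x"
      using assms unfolding traces_def by blast
    then show ?thesis
      using j by (auto simp: nth_append)
  qed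
  then show ?thesis
    using assms by (auto simp: traces_def)
qed

lemma traces_prefix: "\<beta> \<in> traces X \<Longrightarrow> prefix \<alpha> \<beta> \<Longrightarrow> \<alpha> \<in> traces X"
  using traces_appendD by (metis prefixE)

lemma trace_events: "\<alpha> @ [e] \<in> traces X \<Longrightarrow> e \<in> events X"
  by (simp add: traces_def)

text \<open>Traces are closed under prefixes, so a proper extension contains an extension by one
  event.\<close>

lemma max_traces_iff: "\<alpha> \<in> max_traces X \<longleftrightarrow> \<alpha> \<in> traces X \<and> (\<forall>e. \<alpha> @ [e] \<notin> traces X)"
proof
  show "\<alpha> \<in> max_traces X \<Longrightarrow> \<alpha> \<in> traces X \<and> (\<forall>e. \<alpha> @ [e] \<notin> traces X)"
    by (fastforce simp: max_traces_def)
next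
  assume *: "\<alpha> \<in> traces X \<and> (\<forall>e. \<alpha> @ [e] \<notin> traces X)"
  have "\<beta> = \<alpha>" if \<beta>: "\<beta> \<in> traces X" "prefix \<alpha> \<beta>" for \<beta>
  proof -
    obtain \<gamma> where \<gamma>: "\<beta> = \<alpha> @ \<gamma>"
      using \<beta>(2) by (rule prefixE)
    show ?thesis
    proof (cases \<gamma>)
      case (Cons e \<gamma>')
      then have "(\<alpha> @ [e]) @ \<gamma>' \<in> traces X"
        using \<beta>(1) \<gamma> by simp
      then show ?thesis
        using traces_appendD * by blast
    qed (use \<gamma> in simp)
  qed
  with * show "\<alpha> \<in> max_traces X"
    by (auto simp: max_traces_def)
qed

lemma max_traces_subset: "max_traces X \<subseteq> traces X"
  by (auto simp: max_traces_def)

lemma max_traces_prefixD: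
  "\<alpha> \<in> max_traces X \<Longrightarrow> \<beta> \<in> traces X \<Longrightarrow> prefix \<alpha> \<beta> \<Longrightarrow> \<beta> = \<alpha>"
  by (auto simp: max_traces_def)

lemma label_convex:
  assumes "is_ipbes X" "e \<in> events X"
  shows "convex (label X e t)"
proof -
  have "label X e \<in> progs \<union> tests"
    using assms by (auto simp: is_ipbes_def)
  moreover have "label X e t = {} \<or> label X e t = {point_dist t}" if "label X e \<in> tests"
    using that by (auto simp: tests_def)
  ultimately show ?thesis
    by (auto simp: progs_def)
qed

lemma point_dist_in_dists: "point_dist s \<in> dists"
  by (auto simp: point_dist_def dists_def axis_def sum.delta)

lemma label_subset_dists:
  assumes "is_ipbes X" "e \<in> events X"
  shows "label X e t \<subseteq> dists"
proof -
  have "label X e \<in> progs \<union> tests"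
    using assms by (auto simp: is_ipbes_def)
  moreover have "label X e t \<subseteq> {point_dist t}" if "label X e \<in> tests"
    using that by (auto simp: tests_def)
  ultimately show ?thesis
    using point_dist_in_dists by (fastforce simp: progs_def)
qed

text \<open>The case of an empty label is absorbed: there \<open>w = 0\<close> and \<open>\<mu>\<close> is arbitrary.\<close>

lemma scheduler_weights:
  fixes X :: "('e, 's::finite) ipbes"
  assumes "scheduler X \<sigma>"
  obtains w :: "'e list \<Rightarrow> 'e \<Rightarrow> 's \<Rightarrow> real" and \<mu> :: "'e list \<Rightarrow> 'e \<Rightarrow> 's \<Rightarrow> real ^ 's" where
    "\<And>\<alpha> e t. \<alpha> @ [e] \<in> traces X \<Longrightarrow> 0 \<le> w \<alpha> e t"
    "\<And>\<alpha> e t. \<alpha> @ [e] \<in> traces X \<Longrightarrow> the (\<sigma> \<alpha> (e, t)) = w \<alpha> e t *\<^sub>R \<mu> \<alpha> e t"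
    "\<And>\<alpha> e t. \<alpha> @ [e] \<in> traces X \<Longrightarrow> \<mu> \<alpha> e t \<in> label X e t \<or> w \<alpha> e t = 0"
    "\<And>\<alpha> t. \<alpha> \<in> traces X \<Longrightarrow> \<alpha> \<notin> max_traces X \<Longrightarrow>
       ((\<lambda>e. w \<alpha> e t) has_sum 1) {e. \<alpha> @ [e] \<in> traces X}"
proof -
  let ?P = "\<lambda>\<alpha> w. (\<forall>e t. \<alpha> @ [e] \<in> traces X \<longrightarrow> 0 \<le> w (e, t) \<and>
      (\<exists>\<mu>. the (\<sigma> \<alpha> (e, t)) = w (e, t) *\<^sub>R \<mu> \<and> (\<mu> \<in> label X e t \<or> w (e, t) = 0))) \<and>
      (\<alpha> \<notin> max_traces X \<longrightarrow> (\<forall>t. ((\<lambda>e. w (e, t)) has_sum 1) {e. \<alpha> @ [e] \<in> traces X}))"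
  have "\<exists>w. ?P \<alpha> w" if \<alpha>: "\<alpha> \<in> traces X" for \<alpha>
  proof -
    obtain w :: "'e \<times> 's \<Rightarrow> real" where
      dom: "dom (\<sigma> \<alpha>) = {(e, s). \<alpha> @ [e] \<in> traces X}" and
      w: "\<forall>e\<in>events X. \<forall>s. 0 \<le> w (e, s)" and
      v: "\<forall>(e, s)\<in>dom (\<sigma> \<alpha>).
           (label X e s \<noteq> {} \<longrightarrow> (\<exists>\<mu>\<in>label X e s. \<sigma> \<alpha> (e, s) = Some (w (e, s) *\<^sub>R \<mu>))) \<and>
           (label X e s = {} \<longrightarrow> w (e, s) = 0 \<and> \<sigma> \<alpha> (e, s) = Some 0)" and
      sum: "dom (\<sigma> \<alpha>) \<noteq> {} \<longrightarrow>
           (\<forall>s. ((\<lambda>e. w (e, s)) has_sum 1) {e. \<alpha> @ [e] \<in> traces X})"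
      using bspec[OF assms[unfolded scheduler_def] \<alpha>] by (elim conjE exE) (rule that, auto)
    have "?P \<alpha> w"
    proof (intro conjI allI impI)
      fix e t assume e: "\<alpha> @ [e] \<in> traces X"
      show "0 \<le> w (e, t)"
        using w trace_events[OF e] by auto
      have "(label X e t \<noteq> {} \<longrightarrow> (\<exists>\<mu>\<in>label X e t. \<sigma> \<alpha> (e, t) = Some (w (e, t) *\<^sub>R \<mu>))) \<and>
           (label X e t = {} \<longrightarrow> w (e, t) = 0 \<and> \<sigma> \<alpha> (e, t) = Some 0)"
        using v e unfolding dom by blast
      then show "\<exists>\<mu>. the (\<sigma> \<alpha> (e, t)) = w (e, t) *\<^sub>R \<mu> \<and> (\<mu> \<in> label X e t \<or> w (e, t) = 0)"
        by (metis option.sel scaleR_zero_left)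
    next
      fix t assume "\<alpha> \<notin> max_traces X"
      then have "dom (\<sigma> \<alpha>) \<noteq> {}"
        using \<alpha> unfolding dom by (auto simp: max_traces_iff)
      then show "((\<lambda>e. w (e, t)) has_sum 1) {e. \<alpha> @ [e] \<in> traces X}"
        using sum by blast
    qed
    then show ?thesis
      by (rule exI[of _ w])
  qed
  then obtain w where w: "\<And>\<alpha>. \<alpha> \<in> traces X \<Longrightarrow> ?P \<alpha> (w \<alpha>)"
    by metis
  then have "\<exists>\<mu>. \<alpha> @ [e] \<in> traces X \<longrightarrow> the (\<sigma> \<alpha> (e, t)) = w \<alpha> (e, t) *\<^sub>R \<mu> \<and>
      (\<mu> \<in> label X e t \<or> w \<alpha> (e, t) = 0)" for \<alpha> e t
    using traces_appendD by blast
  then obtain \<mu> where "\<And>\<alpha> e t. \<alpha> @ [e] \<in> traces X \<longrightarrow>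
      the (\<sigma> \<alpha> (e, t)) = w \<alpha> (e, t) *\<^sub>R \<mu> \<alpha> e t \<and> (\<mu> \<alpha> e t \<in> label X e t \<or> w \<alpha> (e, t) = 0)"
    by metis
  with w show thesis
    by (intro that[of "\<lambda>\<alpha> e t. w \<alpha> (e, t)" \<mu>]) (blast dest: traces_appendD)+
qed

section \<open>Flows on the trace tree\<close>

text \<open>Here \<open>\<phi> \<alpha>\<close> is the mass distribution at \<open>\<alpha>\<close>, and \<open>v (\<alpha> @ [e]) t\<close> is the share of the mass
  of \<open>\<alpha>\<close> in state \<open>t\<close> that is scheduled to perform \<open>e\<close>.\<close>

definition trace_flow ::
  "('e, 's::finite) ipbes \<Rightarrow> ('e list \<Rightarrow> real ^ 's) \<Rightarrow> ('e list \<Rightarrow> 's \<Rightarrow> real) \<Rightarrow> bool" where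
  "trace_flow X \<phi> v \<longleftrightarrow>
     (\<forall>\<alpha>\<in>traces X. \<forall>t. 0 \<le> \<phi> \<alpha> $ t) \<and>
     (\<forall>\<alpha> e. \<alpha> @ [e] \<in> traces X \<longrightarrow>
        (\<forall>t. 0 \<le> v (\<alpha> @ [e]) t) \<and>
        (\<exists>\<mu>. (\<forall>t. \<mu> t \<in> label X e t \<or> v (\<alpha> @ [e]) t = 0) \<and>
             \<phi> (\<alpha> @ [e]) = (\<Sum>t\<in>UNIV. v (\<alpha> @ [e]) t *\<^sub>R \<mu> t))) \<and>
     (\<forall>\<alpha>\<in>traces X - max_traces X. \<forall>t.
        ((\<lambda>e. v (\<alpha> @ [e]) t) has_sum \<phi> \<alpha> $ t) {e. \<alpha> @ [e] \<in> traces X})"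

lemma trace_flow_nonneg: "trace_flow X \<phi> v \<Longrightarrow> \<alpha> \<in> traces X \<Longrightarrow> 0 \<le> \<phi> \<alpha> $ t"
  by (simp add: trace_flow_def)

lemma trace_flow_edge_nonneg: "trace_flow X \<phi> v \<Longrightarrow> \<alpha> @ [e] \<in> traces X \<Longrightarrow> 0 \<le> v (\<alpha> @ [e]) t"
  by (simp add: trace_flow_def)

lemma trace_flow_edge:
  assumes "trace_flow X \<phi> v" "\<alpha> @ [e] \<in> traces X"
  obtains \<mu> where "\<And>t. \<mu> t \<in> label X e t \<or> v (\<alpha> @ [e]) t = 0"
    "\<phi> (\<alpha> @ [e]) = (\<Sum>t\<in>UNIV. v (\<alpha> @ [e]) t *\<^sub>R \<mu> t)"
proof -
  have "\<exists>\<mu>. (\<forall>t. \<mu> t \<in> label X e t \<or> v (\<alpha> @ [e]) t = 0) \<and>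
      \<phi> (\<alpha> @ [e]) = (\<Sum>t\<in>UNIV. v (\<alpha> @ [e]) t *\<^sub>R \<mu> t)"
    using assms by (simp add: trace_flow_def)
  then show thesis
    using that by blast
qed

lemma trace_flow_has_sum:
  "trace_flow X \<phi> v \<Longrightarrow> \<alpha> \<in> traces X \<Longrightarrow> \<alpha> \<notin> max_traces X \<Longrightarrow>
    ((\<lambda>e. v (\<alpha> @ [e]) t) has_sum \<phi> \<alpha> $ t) {e. \<alpha> @ [e] \<in> traces X}"
  by (simp add: trace_flow_def)

section \<open>Mass conservation and convergence of flows\<close>

abbreviation mass :: "real ^ 's::finite \<Rightarrow> real" where
  "mass \<mu> \<equiv> \<Sum>t\<in>UNIV. \<mu> $ t"

text \<open>Every label consists of distributions, so performing an event redistributes mass over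
  the states without changing its amount.\<close>

lemma trace_flow_mass_step:
  assumes "is_ipbes X" "trace_flow X \<phi> v" "\<alpha> @ [e] \<in> traces X"
  shows "mass (\<phi> (\<alpha> @ [e])) = (\<Sum>t\<in>UNIV. v (\<alpha> @ [e]) t)"
proof -
  obtain \<mu> where \<mu>: "\<And>t. \<mu> t \<in> label X e t \<or> v (\<alpha> @ [e]) t = 0"
    and \<phi>: "\<phi> (\<alpha> @ [e]) = (\<Sum>t\<in>UNIV. v (\<alpha> @ [e]) t *\<^sub>R \<mu> t)"
    using trace_flow_edge[OF assms(2,3)] by blast
  have "v (\<alpha> @ [e]) t * mass (\<mu> t) = v (\<alpha> @ [e]) t" for t
  proof (cases "v (\<alpha> @ [e]) t = 0")
    case False
    then have "\<mu> t \<in> dists"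
      using \<mu> label_subset_dists[OF assms(1) trace_events[OF assms(3)]] by blast
    then show ?thesis
      by (simp add: dists_def)
  qed simp
  moreover have "mass (\<phi> (\<alpha> @ [e])) = (\<Sum>t\<in>UNIV. v (\<alpha> @ [e]) t * mass (\<mu> t))"
    unfolding \<phi> by (simp add: sum_distrib_left) (rule sum.swap)
  ultimately show ?thesis
    by (simp only:)
qed

text \<open>Mass splits along disjoint branches, as in Kraft's inequality. Induction on the depth
  \<open>n\<close> of \<open>S\<close> below \<open>\<alpha>\<close>: the members are grouped by
  their first event after \<open>\<alpha>\<close>, each group is bounded by the mass of that branch,
  and the branches together receive at most the mass of \<open>\<alpha>\<close>. If
  \<open>\<alpha>\<close> itself is in \<open>S\<close>, the antichain condition leaves nothing
  else.\<close>

lemma trace_flow_antichain_mass: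
  assumes "is_ipbes X" "trace_flow X \<phi> v"
  shows "\<lbrakk>\<alpha> \<in> traces X; finite S; S \<subseteq> traces X; \<And>\<beta> \<gamma>. \<beta> \<in> S \<Longrightarrow> \<gamma> \<in> S \<Longrightarrow> prefix \<beta> \<gamma> \<Longrightarrow> \<beta> = \<gamma>;
      \<And>\<beta>. \<beta> \<in> S \<Longrightarrow> prefix \<alpha> \<beta> \<and> length \<beta> \<le> length \<alpha> + n\<rbrakk>
    \<Longrightarrow> (\<Sum>\<beta>\<in>S. mass (\<phi> \<beta>)) \<le> mass (\<phi> \<alpha>)"
proof (induction n arbitrary: \<alpha> S)
  have nonneg: "0 \<le> mass (\<phi> \<alpha>)" if "\<alpha> \<in> traces X" for \<alpha>
    using trace_flow_nonneg[OF assms(2) that] by (simp add: sum_nonneg)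
  case 0
  have "\<beta> = \<alpha>" if "\<beta> \<in> S" for \<beta>
    using 0(5)[OF that] by (auto elim: prefixE)
  then have "S \<subseteq> {\<alpha>}"
    by blast
  then consider "S = {}" | "S = {\<alpha>}"
    by blast
  then show ?case
    using nonneg[OF 0(1)] by cases auto
next
  case (Suc n)
  show ?case
  proof (cases "\<alpha> \<in> S")
    case True
    then have "S = {\<alpha>}"
      using Suc.prems(4,5) by blast
    then show ?thesis
      by simp
  next
    case False
    \<comment> \<open>The event by which \<open>\<beta>\<close> leaves \<open>\<alpha>\<close>; it
      is meaningful because \<open>\<alpha>\<close> is a proper prefix of every member of
      \<open>S\<close>.\<close>
    define h where "h \<beta> = \<beta> ! length \<alpha>" for \<beta> :: "'a list"
    have pre: "prefix (\<alpha> @ [h \<beta>]) \<beta>" if "\<beta> \<in> S" for \<beta>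
    proof -
      obtain \<gamma> where "\<beta> = \<alpha> @ \<gamma>"
        using Suc.prems(5) \<open>\<beta> \<in> S\<close> by (metis prefixE)
      moreover have "\<gamma> \<noteq> []"
        using False that calculation by auto
      ultimately show ?thesis
        by (cases \<gamma>) (auto simp: h_def nth_append)
    qed
    then have tr: "\<alpha> @ [h \<beta>] \<in> traces X" if "\<beta> \<in> S" for \<beta>
      using that Suc.prems(3) traces_prefix by blast
    have le: "(\<Sum>\<beta> | \<beta> \<in> S \<and> h \<beta> = e. mass (\<phi> \<beta>)) \<le> mass (\<phi> (\<alpha> @ [e]))" if "e \<in> h ` S" for e
    proof (rule Suc.IH)
      show "prefix (\<alpha> @ [e]) \<beta> \<and> length \<beta> \<le> length (\<alpha> @ [e]) + n" if "\<beta> \<in> {\<beta> \<in> S. h \<beta> = e}" for \<beta>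
        using that pre[of \<beta>] Suc.prems(5)[of \<beta>] by auto
    qed (use that tr Suc.prems in auto)
    have "(\<Sum>e\<in>h ` S. v (\<alpha> @ [e]) t) \<le> \<phi> \<alpha> $ t" for t
    proof (cases "S = {}")
      case True
      then show ?thesis
        using trace_flow_nonneg[OF assms(2) Suc.prems(1)] by simp
    next
      case False
      then have "\<alpha> \<notin> max_traces X"
        using tr by (auto simp: max_traces_iff)
      from trace_flow_has_sum[OF assms(2) Suc.prems(1) this] show ?thesis
        by (rule finite_sum_le_has_sum)
          (use tr Suc.prems(2) trace_flow_edge_nonneg[OF assms(2)] in auto)
    qed
    then have "(\<Sum>t\<in>UNIV. \<Sum>e\<in>h ` S. v (\<alpha> @ [e]) t) \<le> mass (\<phi> \<alpha>)"
      by (rule sum_mono)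
    moreover have "(\<Sum>\<beta>\<in>S. mass (\<phi> \<beta>)) = (\<Sum>e\<in>h ` S. \<Sum>\<beta> | \<beta> \<in> S \<and> h \<beta> = e. mass (\<phi> \<beta>))"
      by (rule sum.image_gen) (rule Suc.prems(2))
    moreover have "\<dots> \<le> (\<Sum>e\<in>h ` S. mass (\<phi> (\<alpha> @ [e])))"
      by (rule sum_mono) (rule le)
    moreover have "\<dots> = (\<Sum>e\<in>h ` S. \<Sum>t\<in>UNIV. v (\<alpha> @ [e]) t)"
      by (rule sum.cong) (use trace_flow_mass_step[OF assms] tr in auto)
    moreover have "\<dots> = (\<Sum>t\<in>UNIV. \<Sum>e\<in>h ` S. v (\<alpha> @ [e]) t)"
      by (rule sum.swap)
    ultimately show ?thesis
      by linarith
  qed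
qed

text \<open>On nonnegative vectors the mass is the 1-norm and dominates the Euclidean norm, so
  bounded masses of finite sets give absolute summability. The total is only bounded by the initial
  mass, since mass may escape along ever longer traces.\<close>

lemma trace_flow_total:
  fixes X :: "('e, 's::finite) ipbes"
  assumes "is_ipbes X" "trace_flow X \<phi> v"
  shows "\<phi> summable_on max_traces X" "0 \<le> infsum \<phi> (max_traces X) $ t"
    "mass (infsum \<phi> (max_traces X)) \<le> mass (\<phi> [])"
proof -
  note nonneg = trace_flow_nonneg[OF assms(2)]
  have max: "\<alpha> \<in> traces X" if "\<alpha> \<in> max_traces X" for \<alpha>
    using that max_traces_subset by blast
  \<comment> \<open>Maximal traces form an antichain, and a finite set of them has bounded
    depth.\<close>
  have bound: "(\<Sum>\<alpha>\<in>S. mass (\<phi> \<alpha>)) \<le> mass (\<phi> [])" if S: "finite S" "S \<subseteq> max_traces X" for S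
  proof (rule trace_flow_antichain_mass[OF assms Nil_in_traces S(1), where n = "Max (length ` S)"])
    show "S \<subseteq> traces X"
      using S max by blast
    show "\<beta> = \<gamma>" if "\<beta> \<in> S" "\<gamma> \<in> S" "prefix \<beta> \<gamma>" for \<beta> \<gamma>
      using that S(2) max max_traces_prefixD by blast
    show "prefix [] \<beta> \<and> length \<beta> \<le> length ([] :: 'e list) + Max (length ` S)" if "\<beta> \<in> S" for \<beta>
      using that S(1) by simp
  qed
  have mass: "(\<lambda>\<alpha>. mass (\<phi> \<alpha>)) summable_on max_traces X"
  proof (rule nonneg_bdd_above_summable_on)
    show "bdd_above (sum (\<lambda>\<alpha>. mass (\<phi> \<alpha>)) ` {F. F \<subseteq> max_traces X \<and> finite F})"
      using bound by (auto intro!: bdd_aboveI)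
  qed (use nonneg max in \<open>auto intro: sum_nonneg\<close>)
  have le: "norm (\<phi> \<alpha>) \<le> mass (\<phi> \<alpha>)" if "\<alpha> \<in> max_traces X" for \<alpha>
    using norm_le_l1_cart[of "\<phi> \<alpha>"] nonneg[OF max[OF that]] by simp
  show sum: "\<phi> summable_on max_traces X"
    by (rule abs_summable_summable[OF Infinite_Sum.abs_summable_on_comparison_test'[OF mass le]])
  have "bounded_linear (\<lambda>x :: real ^ 's. mass x)"
    by (rule bounded_linear_sum) (rule bounded_linear_vec_nth)
  from has_sum_bounded_linear[OF this has_sum_infsum[OF sum]]
  show "mass (infsum \<phi> (max_traces X)) \<le> mass (\<phi> [])"
    by (rule has_sum_le_finite_sums) (use bound in \<open>auto simp: o_def\<close>)
  show "0 \<le> infsum \<phi> (max_traces X) $ t"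
    using has_sum_bounded_linear[OF bounded_linear_vec_nth[of t] has_sum_infsum[OF sum]]
    by (rule has_sum_nonneg) (use nonneg max in \<open>auto simp: o_def\<close>)
qed

section \<open>From schedulers to flows and back\<close>

text \<open>\<open>reach\<close> is linear in the initial vector, so the runs from all states can be
  superposed with weights \<open>\<iota>\<close>; an edge carries the scheduler's weight times the
  mass present.\<close>

lemma scheduler_trace_flow:
  fixes X :: "('e, 's::finite) ipbes"
  assumes "is_ipbes X" "scheduler X \<sigma>" and \<iota>: "\<And>s. 0 \<le> \<iota> s"
  shows "\<exists>v. trace_flow X (\<lambda>\<alpha>. \<Sum>s\<in>UNIV. \<iota> s *\<^sub>R reach \<sigma> s \<alpha>) v"
proof -
  obtain w :: "'e list \<Rightarrow> 'e \<Rightarrow> 's \<Rightarrow> real" and \<mu> :: "'e list \<Rightarrow> 'e \<Rightarrow> 's \<Rightarrow> real ^ 's" where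
    w: "\<And>\<alpha> e t. \<alpha> @ [e] \<in> traces X \<Longrightarrow> 0 \<le> w \<alpha> e t" and
    \<sigma>: "\<And>\<alpha> e t. \<alpha> @ [e] \<in> traces X \<Longrightarrow> the (\<sigma> \<alpha> (e, t)) = w \<alpha> e t *\<^sub>R \<mu> \<alpha> e t" and
    \<mu>: "\<And>\<alpha> e t. \<alpha> @ [e] \<in> traces X \<Longrightarrow> \<mu> \<alpha> e t \<in> label X e t \<or> w \<alpha> e t = 0" and
    sum: "\<And>\<alpha> t. \<alpha> \<in> traces X \<Longrightarrow> \<alpha> \<notin> max_traces X \<Longrightarrow>
       ((\<lambda>e. w \<alpha> e t) has_sum 1) {e. \<alpha> @ [e] \<in> traces X}"
    using scheduler_weights[OF assms(2)] by blast
  define \<phi> where "\<phi> \<alpha> = (\<Sum>s\<in>UNIV. \<iota> s *\<^sub>R reach \<sigma> s \<alpha>)" for \<alpha>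
  define v where "v \<alpha> t = w (butlast \<alpha>) (last \<alpha>) t * \<phi> (butlast \<alpha>) $ t" for \<alpha> t
  have step: "\<phi> (\<alpha> @ [e]) = (\<Sum>t\<in>UNIV. v (\<alpha> @ [e]) t *\<^sub>R \<mu> \<alpha> e t)"
    if "\<alpha> @ [e] \<in> traces X" for \<alpha> e
  proof -
    have "\<phi> (\<alpha> @ [e]) $ u = (\<Sum>t\<in>UNIV. v (\<alpha> @ [e]) t *\<^sub>R \<mu> \<alpha> e t) $ u" for u
    proof -
      have "\<phi> (\<alpha> @ [e]) $ u =
          (\<Sum>s\<in>UNIV. \<Sum>t\<in>UNIV. \<iota> s * (w \<alpha> e t * \<mu> \<alpha> e t $ u * reach \<sigma> s \<alpha> $ t))"
        by (simp add: \<phi>_def \<sigma>[OF that] sum_distrib_left)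
      also have "\<dots> = (\<Sum>t\<in>UNIV. \<Sum>s\<in>UNIV. \<iota> s * (w \<alpha> e t * \<mu> \<alpha> e t $ u * reach \<sigma> s \<alpha> $ t))"
        by (rule sum.swap)
      also have "\<dots> = (\<Sum>t\<in>UNIV. v (\<alpha> @ [e]) t *\<^sub>R \<mu> \<alpha> e t) $ u"
        by (simp add: v_def \<phi>_def sum_distrib_left sum_distrib_right mult_ac)
      finally show ?thesis .
    qed
    then show ?thesis
      by (simp add: vec_eq_iff)
  qed
  have nonneg: "\<alpha> \<in> traces X \<Longrightarrow> 0 \<le> \<phi> \<alpha> $ t" for \<alpha> t
  proof (induction \<alpha> arbitrary: t rule: rev_induct)
    case Nil
    show ?case
      using \<iota> by (auto simp: \<phi>_def point_dist_def axis_def intro!: sum_nonneg)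
  next
    case (snoc e \<alpha>)
    \<comment> \<open>Where the weight vanishes, \<open>\<mu>\<close> may be any vector and its sign
      is unknown; the zero factor settles that case.\<close>
    have "0 \<le> v (\<alpha> @ [e]) s * \<mu> \<alpha> e s $ t" for s
    proof (cases "w \<alpha> e s = 0")
      case False
      then have "\<mu> \<alpha> e s \<in> dists"
        using \<mu>[OF snoc.prems, of s] label_subset_dists[OF assms(1) trace_events[OF snoc.prems]]
        by blast
      then show ?thesis
        using w[OF snoc.prems] snoc.IH[OF traces_appendD[OF snoc.prems]]
        by (simp add: v_def dists_def)
    qed (simp add: v_def)
    then show ?case
      unfolding step[OF snoc.prems] by (simp add: sum_nonneg)
  qed
  have "trace_flow X \<phi> v"
    unfolding trace_flow_def
  proof (intro conjI ballI allI impI)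
    fix \<alpha> e assume e: "\<alpha> @ [e] \<in> traces X"
    show "0 \<le> v (\<alpha> @ [e]) t" for t
      using nonneg w[OF e] traces_appendD[OF e] by (simp add: v_def)
    show "\<exists>\<mu>. (\<forall>t. \<mu> t \<in> label X e t \<or> v (\<alpha> @ [e]) t = 0) \<and>
             \<phi> (\<alpha> @ [e]) = (\<Sum>t\<in>UNIV. v (\<alpha> @ [e]) t *\<^sub>R \<mu> t)"
      using \<mu>[OF e] step[OF e] by (intro exI[of _ "\<mu> \<alpha> e"]) (auto simp: v_def)
  next
    fix \<alpha> t assume "\<alpha> \<in> traces X - max_traces X"
    then show "((\<lambda>e. v (\<alpha> @ [e]) t) has_sum \<phi> \<alpha> $ t) {e. \<alpha> @ [e] \<in> traces X}"
      using has_sum_cmult_left[OF sum[of \<alpha> t], of "\<phi> \<alpha> $ t"] by (simp add: v_def)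
  qed (use nonneg in blast)
  then show ?thesis
    unfolding \<phi>_def by blast
qed

text \<open>Converse of \<open>scheduler_weights\<close>. The upper bound 1 on the weights follows
  because a single nonnegative term is at most the whole sum; it also keeps the scaled distributions
  subdistributions.\<close>

lemma scheduler_of_weights:
  fixes X :: "('e, 's::finite) ipbes"
  assumes "is_ipbes X"
    and w: "\<And>\<alpha> e t. \<alpha> @ [e] \<in> traces X \<Longrightarrow> 0 \<le> w \<alpha> e t"
    and \<mu>: "\<And>\<alpha> e t. \<alpha> @ [e] \<in> traces X \<Longrightarrow> \<mu> \<alpha> e t \<in> label X e t \<or> w \<alpha> e t = 0"
    and sum: "\<And>\<alpha> t. \<alpha> \<in> traces X \<Longrightarrow> \<alpha> \<notin> max_traces X \<Longrightarrow>
       ((\<lambda>e. w \<alpha> e t) has_sum 1) {e. \<alpha> @ [e] \<in> traces X}"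
  shows "scheduler X (\<lambda>\<alpha> (e, t). if \<alpha> @ [e] \<in> traces X then Some (w \<alpha> e t *\<^sub>R \<mu> \<alpha> e t) else None)"
    (is "scheduler X ?\<sigma>")
  unfolding scheduler_def
proof (intro ballI conjI)
  fix \<alpha> assume \<alpha>: "\<alpha> \<in> traces X"
  show dom: "dom (?\<sigma> \<alpha>) = {(e, s). \<alpha> @ [e] \<in> traces X}"
    by (auto simp: dom_def split: if_splits)
  have le: "w \<alpha> e t \<le> 1" if e: "\<alpha> @ [e] \<in> traces X" for e t
  proof -
    have "\<alpha> \<notin> max_traces X"
      using e by (auto simp: max_traces_iff)
    from finite_sum_le_has_sum[OF sum[OF \<alpha> this], of "{e}"] e w show ?thesis
      by auto
  qed
  show "ran (?\<sigma> \<alpha>) \<subseteq> subdists"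
  proof
    fix x assume "x \<in> ran (?\<sigma> \<alpha>)"
    then obtain e t where e: "\<alpha> @ [e] \<in> traces X" and x: "x = w \<alpha> e t *\<^sub>R \<mu> \<alpha> e t"
      by (auto simp: ran_def split: if_splits)
    show "x \<in> subdists"
    proof (cases "w \<alpha> e t = 0")
      case False
      then have "\<mu> \<alpha> e t \<in> dists"
        using \<mu>[OF e, of t] label_subset_dists[OF assms(1) trace_events[OF e]] by blast
      then show ?thesis
        using w[OF e] le[OF e] by (auto simp: x subdists_def dists_def simp flip: sum_distrib_left)
    qed (simp add: x subdists_def)
  qed
  show "\<exists>w. (\<forall>e\<in>events X. \<forall>s. 0 \<le> w (e, s) \<and> w (e, s) \<le> 1) \<and>
      (\<forall>(e, s)\<in>dom (?\<sigma> \<alpha>).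
         (label X e s \<noteq> {} \<longrightarrow> (\<exists>\<mu>\<in>label X e s. ?\<sigma> \<alpha> (e, s) = Some (w (e, s) *\<^sub>R \<mu>))) \<and>
         (label X e s = {} \<longrightarrow> w (e, s) = 0 \<and> ?\<sigma> \<alpha> (e, s) = Some 0)) \<and>
      (dom (?\<sigma> \<alpha>) \<noteq> {} \<longrightarrow> (\<forall>s. ((\<lambda>e. w (e, s)) has_sum 1) {e. \<alpha> @ [e] \<in> traces X}))"
  proof (intro exI conjI ballI allI impI)
    \<comment> \<open>A scheduler's weights must lie in [0, 1] at every event, but \<open>w\<close>
      is controlled only at events that extend \<open>\<alpha>\<close>; elsewhere 0 is
      taken.\<close>
    let ?w = "\<lambda>(e, t). if \<alpha> @ [e] \<in> traces X then w \<alpha> e t else 0"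
    show "0 \<le> ?w (e, s)" "?w (e, s) \<le> 1" for e s
      using w le by auto
    show "case p of (e, s) \<Rightarrow>
         (label X e s \<noteq> {} \<longrightarrow> (\<exists>\<mu>\<in>label X e s. ?\<sigma> \<alpha> (e, s) = Some (?w (e, s) *\<^sub>R \<mu>))) \<and>
         (label X e s = {} \<longrightarrow> ?w (e, s) = 0 \<and> ?\<sigma> \<alpha> (e, s) = Some 0)"
      if p: "p \<in> dom (?\<sigma> \<alpha>)" for p
    proof -
      obtain e t where e: "p = (e, t)" "\<alpha> @ [e] \<in> traces X"
        using p unfolding dom by blast
      show ?thesis
        using \<mu>[OF e(2), of t] e by auto
    qed
    show "((\<lambda>e. ?w (e, s)) has_sum 1) {e. \<alpha> @ [e] \<in> traces X}" if "dom (?\<sigma> \<alpha>) \<noteq> {}" for s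
    proof -
      have "\<alpha> \<notin> max_traces X"
        using that unfolding dom by (auto simp: max_traces_iff)
      from sum[OF \<alpha> this] show ?thesis
        by (rule has_sum_cong[THEN iffD1, rotated]) simp
    qed
  qed
qed

text \<open>Where the flow vanishes it prescribes nothing, so there \<open>\<tau>\<^sub>0\<close> is followed.\<close>

lemma trace_flow_scheduler:
  fixes Y :: "('f, 's::finite) ipbes"
  assumes "is_ipbes Y" "trace_flow Y K W" "scheduler Y \<tau>\<^sub>0"
    and init: "K [] = (\<Sum>s\<in>UNIV. \<iota> s *\<^sub>R point_dist s)"
  shows "\<exists>\<tau>. scheduler Y \<tau> \<and> (\<forall>\<beta>\<in>traces Y. (\<Sum>s\<in>UNIV. \<iota> s *\<^sub>R reach \<tau> s \<beta>) = K \<beta>)"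
proof -
  obtain w\<^sub>0 :: "'f list \<Rightarrow> 'f \<Rightarrow> 's \<Rightarrow> real" and \<mu>\<^sub>0 :: "'f list \<Rightarrow> 'f \<Rightarrow> 's \<Rightarrow> real ^ 's" where
    w\<^sub>0: "\<And>\<beta> e t. \<beta> @ [e] \<in> traces Y \<Longrightarrow> 0 \<le> w\<^sub>0 \<beta> e t" and
    "\<And>\<beta> e t. \<beta> @ [e] \<in> traces Y \<Longrightarrow> the (\<tau>\<^sub>0 \<beta> (e, t)) = w\<^sub>0 \<beta> e t *\<^sub>R \<mu>\<^sub>0 \<beta> e t" and
    \<mu>\<^sub>0: "\<And>\<beta> e t. \<beta> @ [e] \<in> traces Y \<Longrightarrow> \<mu>\<^sub>0 \<beta> e t \<in> label Y e t \<or> w\<^sub>0 \<beta> e t = 0" and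
    sum\<^sub>0: "\<And>\<beta> t. \<beta> \<in> traces Y \<Longrightarrow> \<beta> \<notin> max_traces Y \<Longrightarrow>
       ((\<lambda>e. w\<^sub>0 \<beta> e t) has_sum 1) {e. \<beta> @ [e] \<in> traces Y}"
    using scheduler_weights[OF assms(3)] by blast
  note K = trace_flow_nonneg[OF assms(2)] and W = trace_flow_edge_nonneg[OF assms(2)]
    and sum = trace_flow_has_sum[OF assms(2)]
  have "\<exists>\<mu>. \<beta> @ [e] \<in> traces Y \<longrightarrow> (\<forall>t. \<mu> t \<in> label Y e t \<or> W (\<beta> @ [e]) t = 0) \<and>
             K (\<beta> @ [e]) = (\<Sum>t\<in>UNIV. W (\<beta> @ [e]) t *\<^sub>R \<mu> t)" for \<beta> e
    using trace_flow_edge[OF assms(2), of \<beta> e] by blast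
  then obtain \<mu> where "\<And>\<beta> e. \<beta> @ [e] \<in> traces Y \<longrightarrow>
      (\<forall>t. \<mu> \<beta> e t \<in> label Y e t \<or> W (\<beta> @ [e]) t = 0) \<and>
      K (\<beta> @ [e]) = (\<Sum>t\<in>UNIV. W (\<beta> @ [e]) t *\<^sub>R \<mu> \<beta> e t)"
    by metis
  then have \<mu>: "\<And>\<beta> e t. \<beta> @ [e] \<in> traces Y \<Longrightarrow> \<mu> \<beta> e t \<in> label Y e t \<or> W (\<beta> @ [e]) t = 0"
    and step: "\<And>\<beta> e. \<beta> @ [e] \<in> traces Y \<Longrightarrow> K (\<beta> @ [e]) = (\<Sum>t\<in>UNIV. W (\<beta> @ [e]) t *\<^sub>R \<mu> \<beta> e t)"
    by blast+
  \<comment> \<open>The conditional probability of performing \<open>e\<close>, given the trace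
    \<open>\<beta>\<close> and the state \<open>t\<close>.\<close>
  define w where "w \<beta> e t = (if K \<beta> $ t = 0 then w\<^sub>0 \<beta> e t else W (\<beta> @ [e]) t / K \<beta> $ t)" for \<beta> e t
  define M where "M \<beta> e t = (if K \<beta> $ t = 0 then \<mu>\<^sub>0 \<beta> e t else \<mu> \<beta> e t)" for \<beta> e t
  define \<tau> where "\<tau> = (\<lambda>\<beta> (e, t). if \<beta> @ [e] \<in> traces Y then Some (w \<beta> e t *\<^sub>R M \<beta> e t) else None)"
  have "scheduler Y \<tau>"
    unfolding \<tau>_def
  proof (rule scheduler_of_weights[OF assms(1)])
    fix \<beta> e t assume e: "\<beta> @ [e] \<in> traces Y"
    show "0 \<le> w \<beta> e t"
      using w\<^sub>0[OF e] W[OF e] K[OF traces_appendD[OF e]] by (simp add: w_def)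
    show "M \<beta> e t \<in> label Y e t \<or> w \<beta> e t = 0"
      using \<mu>\<^sub>0[OF e] \<mu>[OF e] by (auto simp: w_def M_def)
  next
    fix \<beta> t assume \<beta>: "\<beta> \<in> traces Y" "\<beta> \<notin> max_traces Y"
    show "((\<lambda>e. w \<beta> e t) has_sum 1) {e. \<beta> @ [e] \<in> traces Y}"
      using sum\<^sub>0[OF \<beta>] has_sum_divide_const[OF sum[OF \<beta>, of t], of "K \<beta> $ t"]
      by (cases "K \<beta> $ t = 0") (simp_all add: w_def)
  qed
  moreover have "(\<Sum>s\<in>UNIV. \<iota> s *\<^sub>R reach \<tau> s \<beta>) = K \<beta>" if "\<beta> \<in> traces Y" for \<beta>
    using that
  proof (induction \<beta> rule: rev_induct)
    case Nil
    show ?case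
      by (simp add: init)
  next
    case (snoc e \<beta>)
    have \<beta>: "\<beta> \<in> traces Y" "\<beta> \<notin> max_traces Y"
      using snoc.prems traces_appendD by (auto simp: max_traces_iff)
    have IH: "(\<Sum>s\<in>UNIV. \<iota> s * reach \<tau> s \<beta> $ t) = K \<beta> $ t" for t
      using snoc.IH[OF \<beta>(1)] by (simp add: vec_eq_iff)
    \<comment> \<open>Multiplying by \<open>K\<close> undoes the conditioning. In a state without
      mass, an edge carries at most that mass, hence nothing, and both sides are 0 whatever
      \<open>M\<close> is.\<close>
    have flow: "w \<beta> e t * M \<beta> e t $ u * K \<beta> $ t = W (\<beta> @ [e]) t * \<mu> \<beta> e t $ u" for t u
    proof (cases "K \<beta> $ t = 0")
      case True
      then have "W (\<beta> @ [e]) t = 0"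
        using finite_sum_le_has_sum[OF sum[OF \<beta>, of t], of "{e}"] W snoc.prems
        by (force intro: antisym)
      with True show ?thesis
        by simp
    qed (simp add: w_def M_def)
    \<comment> \<open>The transition does not depend on the initial state, so after swapping the
      sums only the weighted combination of \<open>reach\<close> remains, which the induction
      hypothesis identifies.\<close>
    have "(\<Sum>s\<in>UNIV. \<iota> s *\<^sub>R reach \<tau> s (\<beta> @ [e])) $ u = K (\<beta> @ [e]) $ u" for u
    proof -
      have "(\<Sum>s\<in>UNIV. \<iota> s *\<^sub>R reach \<tau> s (\<beta> @ [e])) $ u =
          (\<Sum>s\<in>UNIV. \<Sum>t\<in>UNIV. \<iota> s * (w \<beta> e t * M \<beta> e t $ u * reach \<tau> s \<beta> $ t))"
        using snoc.prems by (simp add: \<tau>_def sum_distrib_left)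
      also have "\<dots> = (\<Sum>t\<in>UNIV. \<Sum>s\<in>UNIV. \<iota> s * (w \<beta> e t * M \<beta> e t $ u * reach \<tau> s \<beta> $ t))"
        by (rule sum.swap)
      also have "\<dots> = (\<Sum>t\<in>UNIV. w \<beta> e t * M \<beta> e t $ u * K \<beta> $ t)"
        by (simp add: sum_distrib_left mult_ac flip: IH)
      also have "\<dots> = K (\<beta> @ [e]) $ u"
        by (simp add: flow step[OF snoc.prems])
      finally show ?thesis .
    qed
    then show ?case
      by (simp add: vec_eq_iff)
  qed
  ultimately show ?thesis
    by blast
qed

section \<open>Transporting a flow along a simulation\<close>

text \<open>The mass of a maximal trace \<open>\<alpha>\<close> of \<open>X\<close> continues from \<open>f \<alpha>\<close> along skippable events to the
  maximal trace \<open>g \<alpha>\<close> of \<open>Y\<close>. The mass at \<open>\<beta>\<close> thus consists of the mass of the traces of \<open>X\<close> at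
  which \<open>f\<close> arrives at \<open>\<beta>\<close> (\<open>arrive \<beta>\<close>), and of that of the maximal traces whose continuation
  passes through \<open>\<beta>\<close> (\<open>passing \<beta>\<close>).\<close>

locale simulated_flow =
  fixes X :: "('e, 's::finite) ipbes" and Y :: "('f, 's) ipbes"
    and f g :: "'e list \<Rightarrow> 'f list" and \<phi> :: "'e list \<Rightarrow> real ^ 's" and v :: "'e list \<Rightarrow> 's \<Rightarrow> real"
  assumes Y: "is_ipbes Y" and flow: "trace_flow X \<phi> v" and sim: "t_simulation X Y f"
    and g: "\<alpha> \<in> max_traces X \<Longrightarrow>
      g \<alpha> \<in> max_traces Y \<and> (\<exists>es. g \<alpha> = f \<alpha> @ es \<and> (\<forall>e\<in>set es. skip \<sqsubseteq>\<^sub>H label Y e))"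
begin

definition fibre where "fibre \<beta> = {\<alpha> \<in> traces X. f \<alpha> = \<beta>}"

definition arrive where "arrive \<beta> = {\<alpha> \<in> fibre \<beta>. \<alpha> = [] \<or> f (butlast \<alpha>) \<noteq> \<beta>}"

definition passing where
  "passing \<beta> = {\<alpha> \<in> max_traces X. strict_prefix (f \<alpha>) \<beta> \<and> prefix \<beta> (g \<alpha>)}"

definition pushed_mass where "pushed_mass \<beta> = sum \<phi> (arrive \<beta>) + sum \<phi> (passing \<beta>)"

text \<open>An arriving trace contributes the share scheduled for its last event. A passing trace
  contributes all its mass, with the state \<open>t\<close> unchanged, because it is to perform a
  skip.\<close>

definition pushed_edge where
  "pushed_edge \<beta> t = (\<Sum>\<alpha>\<in>arrive \<beta>. v \<alpha> t) + (\<Sum>\<alpha>\<in>passing \<beta>. \<phi> \<alpha> $ t)"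

section \<open>Fibres, arriving traces and passing traces\<close>

lemma f_Nil: "f [] = []"
  and f_traces: "\<alpha> \<in> traces X \<Longrightarrow> f \<alpha> \<in> traces Y"
  and finite_fibre: "\<beta> \<in> traces Y \<Longrightarrow> finite (fibre \<beta>)"
  using sim by (auto simp: t_simulation_def fibre_def)

lemma f_snoc:
  assumes "\<alpha> @ [e] \<in> traces X"
  obtains "f (\<alpha> @ [e]) = f \<alpha>" "label X e \<sqsubseteq>\<^sub>H skip"
  | e' where "f (\<alpha> @ [e]) = f \<alpha> @ [e']" "label X e \<sqsubseteq>\<^sub>H label Y e'"
  using sim assms unfolding t_simulation_def by blast

lemma finite_arrive: "\<beta> \<in> traces Y \<Longrightarrow> finite (arrive \<beta>)"
  using finite_fibre by (simp add: arrive_def)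

text \<open>A trace has finitely many prefixes, and each has a finite fibre.\<close>

lemma finite_reached_below:
  assumes "\<beta> \<in> traces Y"
  shows "finite {\<alpha> \<in> traces X. prefix (f \<alpha>) \<beta>}"
proof (rule finite_subset)
  show "{\<alpha> \<in> traces X. prefix (f \<alpha>) \<beta>} \<subseteq> (\<Union>\<gamma>\<in>set (prefixes \<beta>). fibre \<gamma>)"
    by (auto simp: fibre_def)
  show "finite (\<Union>\<gamma>\<in>set (prefixes \<beta>). fibre \<gamma>)"
    using finite_fibre traces_prefix[OF assms] by auto
qed

lemma finite_passing:
  assumes "\<beta> \<in> traces Y"
  shows "finite (passing \<beta>)"
  by (rule finite_subset[OF _ finite_reached_below[OF assms]])
    (use max_traces_subset in \<open>auto simp: passing_def\<close>)

lemma arrive_passing_disjoint: "arrive \<beta> \<inter> passing \<beta> = {}"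
  by (auto simp: arrive_def passing_def fibre_def)

lemma prefix_g: "\<alpha> \<in> max_traces X \<Longrightarrow> prefix (f \<alpha>) (g \<alpha>)"
  using g by fastforce

lemma g_max: "\<alpha> \<in> max_traces X \<Longrightarrow> g \<alpha> \<in> max_traces Y"
  using g by blast

text \<open>One step of the source extends the image by at most one event, so a trace arriving at
  \<open>\<beta> @ [e']\<close> was over \<open>\<beta>\<close> just before.\<close>

lemma arrive_snoc:
  "arrive (\<beta> @ [e']) = {\<alpha> \<in> traces X. \<alpha> \<noteq> [] \<and> f (butlast \<alpha>) = \<beta> \<and> f \<alpha> = \<beta> @ [e']}"
proof -
  have "\<alpha> \<noteq> [] \<and> f (butlast \<alpha>) = \<beta>"
    if "\<alpha> \<in> traces X" "f \<alpha> = \<beta> @ [e']" "\<alpha> = [] \<or> f (butlast \<alpha>) \<noteq> \<beta> @ [e']" for \<alpha>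
    using that by (cases \<alpha> rule: rev_cases) (auto simp: f_Nil elim: f_snoc)
  then show ?thesis
    by (auto simp: arrive_def fibre_def f_Nil)
qed

lemma passing_snoc:
  "passing (\<beta> @ [e']) = {\<alpha> \<in> max_traces X. prefix (f \<alpha>) \<beta> \<and> prefix (\<beta> @ [e']) (g \<alpha>)}"
  by (auto simp: passing_def strict_prefix_def)

lemma arrive_Nil: "arrive [] = {[]}"
proof -
  have "f (butlast \<alpha>) = []" if "\<alpha> \<in> traces X" "\<alpha> \<noteq> []" "f \<alpha> = []" for \<alpha>
    using that by (cases \<alpha> rule: rev_cases) (auto elim: f_snoc)
  then show ?thesis
    by (auto simp: arrive_def fibre_def f_Nil Nil_in_traces)
qed

lemma pushed_mass_Nil: "pushed_mass [] = \<phi> []"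
  by (simp add: pushed_mass_def arrive_Nil passing_def)

lemma \<phi>_nonneg: "\<alpha> \<in> traces X \<Longrightarrow> 0 \<le> \<phi> \<alpha> $ t"
  by (rule trace_flow_nonneg[OF flow])

lemma v_nonneg:
  assumes "\<alpha> \<in> traces X" "\<alpha> \<noteq> []"
  shows "0 \<le> v \<alpha> t"
  using assms trace_flow_edge_nonneg[OF flow] by (cases \<alpha> rule: rev_cases) auto

section \<open>Conservation of mass at a trace of \<open>Y\<close>\<close>

text \<open>A step inside a fibre has a label below \<open>skip\<close>, so it leaves the state
  fixed: the mass after it equals the scheduled share, state by state.\<close>

lemma silent_edge:
  assumes "\<alpha> \<in> fibre \<beta> - arrive \<beta>"
  shows "v \<alpha> t = \<phi> \<alpha> $ t"
proof -
  obtain \<gamma> e where \<alpha>: "\<alpha> = \<gamma> @ [e]" and tr: "\<gamma> @ [e] \<in> traces X" and f: "f (\<gamma> @ [e]) = f \<gamma>"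
    using assms by (cases \<alpha> rule: rev_cases) (auto simp: arrive_def fibre_def)
  have skip: "label X e \<sqsubseteq>\<^sub>H skip"
    using tr by (rule f_snoc) (use f in auto)
  obtain \<mu> where \<mu>: "\<And>t. \<mu> t \<in> label X e t \<or> v \<alpha> t = 0" "\<phi> \<alpha> = (\<Sum>t\<in>UNIV. v \<alpha> t *\<^sub>R \<mu> t)"
    using trace_flow_edge[OF flow tr] unfolding \<alpha> by blast
  have "v \<alpha> s *\<^sub>R \<mu> s = v \<alpha> s *\<^sub>R point_dist s" for s
    using \<mu>(1)[of s] skip by (auto simp: prog_le_def skip_def)
  then have "\<phi> \<alpha> = (\<Sum>s\<in>UNIV. v \<alpha> s *\<^sub>R point_dist s)"
    using \<mu>(2) by (simp only:)
  then have "\<phi> \<alpha> $ t = (\<Sum>s\<in>UNIV. if t = s then v \<alpha> s else 0)"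
    by (simp add: point_dist_def axis_def if_distrib cong: if_cong)
  then show ?thesis
    by simp
qed

text \<open>What leaves the fibre of \<open>\<beta>\<close> is what arrived in it minus what stops in it.\<close>

lemma fibre_balance:
  assumes \<beta>: "\<beta> \<in> traces Y"
  shows "((\<lambda>\<alpha>. v \<alpha> t) has_sum
      (\<Sum>\<alpha>\<in>arrive \<beta>. \<phi> \<alpha> $ t) - (\<Sum>\<alpha>\<in>fibre \<beta> \<inter> max_traces X. \<phi> \<alpha> $ t))
    {\<alpha> \<in> traces X. \<alpha> \<noteq> [] \<and> f (butlast \<alpha>) = \<beta> \<and> f \<alpha> \<noteq> \<beta>}"
proof -
  let ?v = "\<lambda>\<alpha>. v \<alpha> t"
  let ?D = "{\<alpha> \<in> traces X. \<alpha> \<noteq> [] \<and> f (butlast \<alpha>) = \<beta>}"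
  let ?B = "\<lambda>\<alpha>. (\<lambda>e. \<alpha> @ [e]) ` {e. \<alpha> @ [e] \<in> traces X}"
  note fin = finite_fibre[OF \<beta>]
  \<comment> \<open>All edges out of non-maximal members of the fibre, each indexed by the trace it
    leads to; together they carry the mass of those members.\<close>
  have "(?v has_sum (\<Sum>\<alpha>\<in>fibre \<beta> - max_traces X. \<phi> \<alpha> $ t)) (\<Union>\<alpha>\<in>fibre \<beta> - max_traces X. ?B \<alpha>)"
  proof (rule sum_has_sum)
    fix \<alpha> assume "\<alpha> \<in> fibre \<beta> - max_traces X"
    then have "((\<lambda>e. v (\<alpha> @ [e]) t) has_sum \<phi> \<alpha> $ t) {e. \<alpha> @ [e] \<in> traces X}"
      using trace_flow_has_sum[OF flow] by (simp add: fibre_def)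
    then show "(?v has_sum \<phi> \<alpha> $ t) (?B \<alpha>)"
      by (subst has_sum_reindex) (auto simp: inj_on_def o_def)
  qed (use fin in auto)
  also have "(\<Union>\<alpha>\<in>fibre \<beta> - max_traces X. ?B \<alpha>) = ?D"
  proof (intro set_eqI iffI)
    fix \<alpha> assume \<alpha>: "\<alpha> \<in> ?D"
    then obtain \<gamma> e where "\<alpha> = \<gamma> @ [e]"
      by (cases \<alpha> rule: rev_cases) auto
    with \<alpha> show "\<alpha> \<in> (\<Union>\<alpha>\<in>fibre \<beta> - max_traces X. ?B \<alpha>)"
      by (auto simp: fibre_def max_traces_iff dest: traces_appendD)
  qed (auto simp: fibre_def)
  finally have "(?v has_sum (\<Sum>\<alpha>\<in>fibre \<beta> - max_traces X. \<phi> \<alpha> $ t)) ?D" .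
  \<comment> \<open>The edges that stay in the fibre end in the members that are not arrivals and
    carry exactly the mass of these. Subtracting them cancels the interior mass.\<close>
  moreover have "(?v has_sum (\<Sum>\<alpha>\<in>fibre \<beta> - arrive \<beta>. \<phi> \<alpha> $ t)) (fibre \<beta> - arrive \<beta>)"
    using fin silent_edge by (intro has_sum_finiteI) auto
  moreover have "fibre \<beta> - arrive \<beta> \<subseteq> ?D"
    by (auto simp: fibre_def arrive_def)
  ultimately have "(?v has_sum (\<Sum>\<alpha>\<in>fibre \<beta> - max_traces X. \<phi> \<alpha> $ t)
      - (\<Sum>\<alpha>\<in>fibre \<beta> - arrive \<beta>. \<phi> \<alpha> $ t)) (?D - (fibre \<beta> - arrive \<beta>))"
    by (rule has_sum_Diff)
  also have "?D - (fibre \<beta> - arrive \<beta>) = {\<alpha> \<in> traces X. \<alpha> \<noteq> [] \<and> f (butlast \<alpha>) = \<beta> \<and> f \<alpha> \<noteq> \<beta>}"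
    by (auto simp: fibre_def arrive_def)
  also have "(\<Sum>\<alpha>\<in>fibre \<beta> - max_traces X. \<phi> \<alpha> $ t) - (\<Sum>\<alpha>\<in>fibre \<beta> - arrive \<beta>. \<phi> \<alpha> $ t) =
      (\<Sum>\<alpha>\<in>arrive \<beta>. \<phi> \<alpha> $ t) - (\<Sum>\<alpha>\<in>fibre \<beta> \<inter> max_traces X. \<phi> \<alpha> $ t)"
  proof -
    have "fibre \<beta> - max_traces X = fibre \<beta> - fibre \<beta> \<inter> max_traces X"
      by blast
    moreover have "arrive \<beta> \<subseteq> fibre \<beta>"
      by (auto simp: arrive_def)
    ultimately show ?thesis
      using fin by (simp add: sum_diff)
  qed
  finally show ?thesis .
qed

text \<open>A maximal trace whose continuation runs through \<open>\<beta>\<close> either has its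
  image at \<open>\<beta>\<close> or comes from strictly before it.\<close>

lemma sum_through:
  assumes \<beta>: "\<beta> \<in> traces Y"
  shows "sum \<phi> {\<alpha> \<in> max_traces X. prefix (f \<alpha>) \<beta> \<and> prefix \<beta> (g \<alpha>)} =
    sum \<phi> (fibre \<beta> \<inter> max_traces X) + sum \<phi> (passing \<beta>)"
proof -
  have "{\<alpha> \<in> max_traces X. prefix (f \<alpha>) \<beta> \<and> prefix \<beta> (g \<alpha>)} = fibre \<beta> \<inter> max_traces X \<union> passing \<beta>"
    using max_traces_subset[of X] prefix_g by (auto simp: fibre_def passing_def strict_prefix_def)
  then show ?thesis
    using finite_fibre[OF \<beta>] finite_passing[OF \<beta>]
    by (simp, subst sum.union_disjoint) (auto simp: fibre_def passing_def)
qed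

text \<open>The edges of arriving traces carry the arrivals at \<open>\<beta>\<close> minus the mass
  stopping there, by \<open>fibre_balance\<close>. The edges of passing traces carry on the stopped
  mass together with the mass already passing. The stopped mass cancels in the sum.\<close>

lemma pushed_edge_has_sum:
  assumes \<beta>: "\<beta> \<in> traces Y" "\<beta> \<notin> max_traces Y"
  shows "((\<lambda>e. pushed_edge (\<beta> @ [e]) t) has_sum pushed_mass \<beta> $ t) {e. \<beta> @ [e] \<in> traces Y}"
proof -
  let ?R = "{\<alpha> \<in> max_traces X. prefix (f \<alpha>) \<beta> \<and> prefix \<beta> (g \<alpha>)}"
  let ?D = "{\<alpha> \<in> traces X. \<alpha> \<noteq> [] \<and> f (butlast \<alpha>) = \<beta> \<and> f \<alpha> \<noteq> \<beta>}"
  let ?E = "{e. \<beta> @ [e] \<in> traces Y}"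
  have D: "f \<alpha> = \<beta> @ [last (f \<alpha>)]" if "\<alpha> \<in> ?D" for \<alpha>
    using that by (cases \<alpha> rule: rev_cases) (auto elim: f_snoc)
  have arr: "{\<alpha> \<in> ?D. last (f \<alpha>) = e} = arrive (\<beta> @ [e])" for e
    unfolding arrive_snoc using D by auto
  have "((\<lambda>e. \<Sum>\<alpha> | \<alpha> \<in> ?D \<and> last (f \<alpha>) = e. v \<alpha> t) has_sum
      (\<Sum>\<alpha>\<in>arrive \<beta>. \<phi> \<alpha> $ t) - (\<Sum>\<alpha>\<in>fibre \<beta> \<inter> max_traces X. \<phi> \<alpha> $ t)) ?E"
  proof (rule has_sum_fibres[OF fibre_balance[OF \<beta>(1)]])
    show "last (f \<alpha>) \<in> ?E" if "\<alpha> \<in> ?D" for \<alpha>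
      using D[OF that] f_traces[of \<alpha>] that by simp
    show "finite {\<alpha> \<in> ?D. last (f \<alpha>) = e}" if "e \<in> ?E" for e
      unfolding arr using that finite_arrive by simp
  qed
  then have 1: "((\<lambda>e. \<Sum>\<alpha>\<in>arrive (\<beta> @ [e]). v \<alpha> t) has_sum
      (\<Sum>\<alpha>\<in>arrive \<beta>. \<phi> \<alpha> $ t) - (\<Sum>\<alpha>\<in>fibre \<beta> \<inter> max_traces X. \<phi> \<alpha> $ t)) ?E"
    unfolding arr .
  have finR: "finite ?R"
    by (rule finite_subset[OF _ finite_reached_below[OF \<beta>(1)]]) (use max_traces_subset in auto)
  \<comment> \<open>\<open>g \<alpha>\<close> is maximal and \<open>\<beta>\<close> is not, so the
    continuation goes strictly beyond \<open>\<beta>\<close>; its next event stands at index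
    \<open>length \<beta>\<close>.\<close>
  have R: "prefix (\<beta> @ [g \<alpha> ! length \<beta>]) (g \<alpha>)" if "\<alpha> \<in> ?R" for \<alpha>
  proof -
    from that have "prefix \<beta> (g \<alpha>)"
      by simp
    then obtain \<gamma> where \<gamma>: "g \<alpha> = \<beta> @ \<gamma>"
      by (rule prefixE)
    moreover have "\<gamma> \<noteq> []"
      using \<beta>(2) g_max[of \<alpha>] \<gamma> that by auto
    ultimately show ?thesis
      by (cases \<gamma>) auto
  qed
  have pass: "{\<alpha> \<in> ?R. g \<alpha> ! length \<beta> = e} = passing (\<beta> @ [e])" for e
  proof -
    have "prefix \<beta> (g \<alpha>) \<and> g \<alpha> ! length \<beta> = e" if "prefix (\<beta> @ [e]) (g \<alpha>)" for \<alpha>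
      using that by (auto elim!: prefixE simp: nth_append)
    then show ?thesis
      unfolding passing_snoc using R by blast
  qed
  have "((\<lambda>e. \<Sum>\<alpha> | \<alpha> \<in> ?R \<and> g \<alpha> ! length \<beta> = e. \<phi> \<alpha> $ t) has_sum (\<Sum>\<alpha>\<in>?R. \<phi> \<alpha> $ t)) ?E"
  proof (rule has_sum_fibres)
    show "((\<lambda>\<alpha>. \<phi> \<alpha> $ t) has_sum (\<Sum>\<alpha>\<in>?R. \<phi> \<alpha> $ t)) ?R"
      using finR by (rule has_sum_finite)
    show "g \<alpha> ! length \<beta> \<in> ?E" if "\<alpha> \<in> ?R" for \<alpha>
    proof -
      have "g \<alpha> \<in> traces Y"
        using g_max[of \<alpha>] that max_traces_subset by blast
      then show ?thesis
        using traces_prefix R[OF that] by blast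
    qed
    show "finite {\<alpha> \<in> ?R. g \<alpha> ! length \<beta> = e}" for e
      by (rule rev_finite_subset[OF finR]) auto
  qed
  then have 2: "((\<lambda>e. \<Sum>\<alpha>\<in>passing (\<beta> @ [e]). \<phi> \<alpha> $ t) has_sum (\<Sum>\<alpha>\<in>?R. \<phi> \<alpha> $ t)) ?E"
    unfolding pass .
  have "(\<Sum>\<alpha>\<in>?R. \<phi> \<alpha> $ t) = (\<Sum>\<alpha>\<in>fibre \<beta> \<inter> max_traces X. \<phi> \<alpha> $ t) + (\<Sum>\<alpha>\<in>passing \<beta>. \<phi> \<alpha> $ t)"
    using arg_cong[OF sum_through[OF \<beta>(1)], of "\<lambda>x. x $ t"] by simp
  with has_sum_add[OF 1 2] show ?thesis
    by (simp add: pushed_edge_def pushed_mass_def)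
qed

section \<open>Labels of the pushed edges\<close>

text \<open>Since \<open>f \<alpha>\<close> ends no later than \<open>\<beta>\<close>, the event
  \<open>e\<close> is among the skippable events that \<open>g\<close> appends.\<close>

lemma passing_skip:
  assumes "\<alpha> \<in> passing (\<beta> @ [e])"
  shows "point_dist t \<in> label Y e t"
proof -
  have \<alpha>: "\<alpha> \<in> max_traces X" "prefix (f \<alpha>) \<beta>" "prefix (\<beta> @ [e]) (g \<alpha>)"
    using assms by (auto simp: passing_snoc)
  obtain es where es: "g \<alpha> = f \<alpha> @ es" "\<forall>e\<in>set es. skip \<sqsubseteq>\<^sub>H label Y e"
    using g[OF \<alpha>(1)] by blast
  have "e \<in> set es"
    using \<alpha>(2,3) es(1) by (auto elim!: prefixE)
  then show ?thesis
    using es(2) by (auto simp: prog_le_def skip_def)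
qed

lemma arrive_edge:
  assumes "\<alpha> \<in> arrive (\<beta> @ [e'])"
  shows "\<exists>\<mu>. (\<forall>t. \<mu> t \<in> label Y e' t \<or> v \<alpha> t = 0) \<and> \<phi> \<alpha> = (\<Sum>t\<in>UNIV. v \<alpha> t *\<^sub>R \<mu> t)"
proof -
  obtain \<gamma> e where \<alpha>: "\<alpha> = \<gamma> @ [e]" and tr: "\<gamma> @ [e] \<in> traces X" and f: "f (\<gamma> @ [e]) = f \<gamma> @ [e']"
    using assms by (cases \<alpha> rule: rev_cases) (auto simp: arrive_snoc)
  have le: "label X e \<sqsubseteq>\<^sub>H label Y e'"
    using tr by (rule f_snoc) (use f in auto)
  obtain \<mu> where "\<And>t. \<mu> t \<in> label X e t \<or> v \<alpha> t = 0" "\<phi> \<alpha> = (\<Sum>t\<in>UNIV. v \<alpha> t *\<^sub>R \<mu> t)"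
    using trace_flow_edge[OF flow tr] unfolding \<alpha> by blast
  then show ?thesis
    using le unfolding prog_le_def by blast
qed

text \<open>Each contribution to the edge uses a member of \<open>label Y e t\<close>: one inherited
  from the larger label for an arriving trace, the point distribution for a passing one. Averaging
  them with their shares stays in the label by convexity.\<close>

lemma pushed_step:
  assumes e: "\<beta> @ [e] \<in> traces Y"
  shows "\<exists>\<mu>. (\<forall>t. \<mu> t \<in> label Y e t \<or> pushed_edge (\<beta> @ [e]) t = 0) \<and>
    pushed_mass (\<beta> @ [e]) = (\<Sum>t\<in>UNIV. pushed_edge (\<beta> @ [e]) t *\<^sub>R \<mu> t)"
proof -
  let ?A = "arrive (\<beta> @ [e])" and ?P = "passing (\<beta> @ [e])"
  note fin = finite_arrive[OF e] finite_passing[OF e]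
  have "\<forall>\<alpha>\<in>?A. \<exists>\<mu>. (\<forall>t. \<mu> t \<in> label Y e t \<or> v \<alpha> t = 0) \<and> \<phi> \<alpha> = (\<Sum>t\<in>UNIV. v \<alpha> t *\<^sub>R \<mu> t)"
    using arrive_edge by (rule ballI)
  from bchoice[OF this] obtain \<mu> where \<mu>: "\<forall>\<alpha>\<in>?A.
      (\<forall>t. \<mu> \<alpha> t \<in> label Y e t \<or> v \<alpha> t = 0) \<and> \<phi> \<alpha> = (\<Sum>t\<in>UNIV. v \<alpha> t *\<^sub>R \<mu> \<alpha> t)"
    by (rule exE)
  define w where "w t \<alpha> = (if \<alpha> \<in> ?A then v \<alpha> t else \<phi> \<alpha> $ t)" for t \<alpha>
  define x where "x t \<alpha> = (if \<alpha> \<in> ?A then \<mu> \<alpha> t else point_dist t)" for t \<alpha>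
  have edge: "pushed_edge (\<beta> @ [e]) t = sum (w t) (?A \<union> ?P)" for t
  proof -
    have "sum (w t) ?P = (\<Sum>\<alpha>\<in>?P. \<phi> \<alpha> $ t)"
      using arrive_passing_disjoint by (intro sum.cong) (auto simp: w_def)
    then show ?thesis
      using fin arrive_passing_disjoint by (simp add: sum.union_disjoint pushed_edge_def w_def)
  qed
  \<comment> \<open>For a trace that does not arrive, this is the expansion of the vector in point
    distributions.\<close>
  have \<phi>: "\<phi> \<alpha> = (\<Sum>t\<in>UNIV. w t \<alpha> *\<^sub>R x t \<alpha>)" for \<alpha>
  proof (cases "\<alpha> \<in> ?A")
    case True
    then show ?thesis
      using bspec[OF \<mu> True] by (simp add: w_def x_def)
  next
    case False
    then show ?thesis
      by (simp add: w_def x_def point_dist_def axis_def vec_eq_iff if_distrib cong: if_cong)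
  qed
  have "\<exists>y. (y \<in> label Y e t \<or> sum (w t) (?A \<union> ?P) = 0) \<and>
      (\<Sum>\<alpha>\<in>?A \<union> ?P. w t \<alpha> *\<^sub>R x t \<alpha>) = sum (w t) (?A \<union> ?P) *\<^sub>R y" for t
  proof (rule sum_scaleR_eq_convex_scaleR)
    show "convex (label Y e t)"
      by (rule label_convex[OF Y trace_events[OF e]])
    show "0 \<le> w t \<alpha>" if "\<alpha> \<in> ?A \<union> ?P" for \<alpha>
      using that v_nonneg[of \<alpha> t] \<phi>_nonneg[of \<alpha> t] max_traces_subset[of X]
      by (auto simp: w_def arrive_snoc passing_def)
    show "x t \<alpha> \<in> label Y e t \<or> w t \<alpha> = 0" if "\<alpha> \<in> ?A \<union> ?P" for \<alpha>
      using that \<mu> passing_skip by (auto simp: x_def w_def)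
  qed (use fin in simp)
  then have "\<forall>t. \<exists>y. (y \<in> label Y e t \<or> sum (w t) (?A \<union> ?P) = 0) \<and>
      (\<Sum>\<alpha>\<in>?A \<union> ?P. w t \<alpha> *\<^sub>R x t \<alpha>) = sum (w t) (?A \<union> ?P) *\<^sub>R y"
    by (rule allI)
  from choice[OF this] obtain y where y: "\<And>t. y t \<in> label Y e t \<or> sum (w t) (?A \<union> ?P) = 0"
    "\<And>t. (\<Sum>\<alpha>\<in>?A \<union> ?P. w t \<alpha> *\<^sub>R x t \<alpha>) = sum (w t) (?A \<union> ?P) *\<^sub>R y t"
    by blast
  have "pushed_mass (\<beta> @ [e]) = sum \<phi> (?A \<union> ?P)"
    using fin arrive_passing_disjoint by (simp add: sum.union_disjoint pushed_mass_def)
  also have "\<dots> = (\<Sum>\<alpha>\<in>?A \<union> ?P. \<Sum>t\<in>UNIV. w t \<alpha> *\<^sub>R x t \<alpha>)"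
    by (rule sum.cong) (auto intro: \<phi>)
  also have "\<dots> = (\<Sum>t\<in>UNIV. \<Sum>\<alpha>\<in>?A \<union> ?P. w t \<alpha> *\<^sub>R x t \<alpha>)"
    by (rule sum.swap)
  also have "\<dots> = (\<Sum>t\<in>UNIV. pushed_edge (\<beta> @ [e]) t *\<^sub>R y t)"
    by (simp add: y(2) edge)
  finally show ?thesis
    using y(1) by (auto simp: edge)
qed

section \<open>The pushed flow and its total over maximal traces\<close>

lemma pushed_flow: "trace_flow Y pushed_mass pushed_edge"
  unfolding trace_flow_def
proof (intro conjI ballI allI impI)
  show "0 \<le> pushed_mass \<beta> $ t" for \<beta> t
    using \<phi>_nonneg max_traces_subset[of X]
    by (auto simp: pushed_mass_def arrive_def fibre_def passing_def intro!: add_nonneg_nonneg sum_nonneg)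
  show "0 \<le> pushed_edge (\<beta> @ [e]) t" for \<beta> e t
    using \<phi>_nonneg v_nonneg max_traces_subset[of X]
    by (auto simp: pushed_edge_def arrive_snoc passing_def intro!: add_nonneg_nonneg sum_nonneg)
qed (use pushed_step pushed_edge_has_sum in auto)

text \<open>No edge leaves the fibre of a maximal \<open>\<beta>\<close>, so
  \<open>fibre_balance\<close> equates the mass arriving there with the mass stopping there. A
  continuation through \<open>\<beta>\<close> must also end there.\<close>

lemma pushed_mass_max:
  assumes \<beta>: "\<beta> \<in> max_traces Y"
  shows "pushed_mass \<beta> = (\<Sum>\<alpha> | \<alpha> \<in> max_traces X \<and> g \<alpha> = \<beta>. \<phi> \<alpha>)"
proof -
  have \<beta>': "\<beta> \<in> traces Y"
    using \<beta> max_traces_subset by blast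
  have "f \<alpha> = \<beta>" if "\<alpha> \<in> traces X" "\<alpha> \<noteq> []" "f (butlast \<alpha>) = \<beta>" for \<alpha>
    using that f_traces[of \<alpha>] \<beta> by (cases \<alpha> rule: rev_cases) (auto simp: max_traces_iff elim: f_snoc)
  then have "{\<alpha> \<in> traces X. \<alpha> \<noteq> [] \<and> f (butlast \<alpha>) = \<beta> \<and> f \<alpha> \<noteq> \<beta>} = {}"
    by blast
  from has_sum_unique[OF fibre_balance[OF \<beta>', unfolded this] has_sum_empty]
  have "(\<Sum>\<alpha>\<in>arrive \<beta>. \<phi> \<alpha> $ t) = (\<Sum>\<alpha>\<in>fibre \<beta> \<inter> max_traces X. \<phi> \<alpha> $ t)" for t
    by simp
  then have "sum \<phi> (arrive \<beta>) = sum \<phi> (fibre \<beta> \<inter> max_traces X)"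
    by (simp add: vec_eq_iff)
  moreover have "{\<alpha> \<in> max_traces X. prefix (f \<alpha>) \<beta> \<and> prefix \<beta> (g \<alpha>)} = {\<alpha> \<in> max_traces X. g \<alpha> = \<beta>}"
    using prefix_g g_max max_traces_subset[of Y] max_traces_prefixD[OF \<beta>] by blast
  ultimately show ?thesis
    using sum_through[OF \<beta>'] by (simp add: pushed_mass_def)
qed

text \<open>The maximal traces of \<open>X\<close> are regrouped by \<open>g\<close>. The fibres of
  \<open>g\<close> are finite because \<open>f \<alpha>\<close> is a prefix of
  \<open>g \<alpha>\<close>.\<close>

lemma pushed_mass_has_sum:
  assumes "(\<phi> has_sum S) (max_traces X)"
  shows "(pushed_mass has_sum S) (max_traces Y)"
proof -
  have "finite {\<alpha> \<in> max_traces X. g \<alpha> = \<beta>}" if "\<beta> \<in> max_traces Y" for \<beta>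
    by (rule finite_subset[OF _ finite_reached_below[of \<beta>]])
      (use that max_traces_subset prefix_g in auto)
  then have "((\<lambda>\<beta>. \<Sum>\<alpha> | \<alpha> \<in> max_traces X \<and> g \<alpha> = \<beta>. \<phi> \<alpha>) has_sum S) (max_traces Y)"
    using assms g_max by (intro has_sum_fibres)
  then show ?thesis
    by (rule has_sum_cong[THEN iffD1, rotated]) (simp add: pushed_mass_max)
qed

end

section \<open>Simulation implies refinement\<close>

lemma mass_point_dist: "mass (point_dist s) = 1"
  using point_dist_in_dists[of s] by (simp add: dists_def)

lemma has_sum_finite_combination:
  fixes r :: "'i \<Rightarrow> 'a \<Rightarrow> 'v::real_normed_vector"
  assumes "finite I" "\<And>i. i \<in> I \<Longrightarrow> (r i has_sum S i) A"
  shows "((\<lambda>a. \<Sum>i\<in>I. \<iota> i *\<^sub>R r i a) has_sum (\<Sum>i\<in>I. \<iota> i *\<^sub>R S i)) A"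
  using assms by (induction I) (auto intro!: has_sum_add has_sum_scaleR)

lemma scheduler_outcome:
  fixes X :: "('e, 's::finite) ipbes"
  assumes "is_ipbes X" "scheduler X \<sigma>"
  shows "(reach \<sigma> s has_sum outcome X \<sigma> s) (max_traces X)" "0 \<le> outcome X \<sigma> s $ t"
    "mass (outcome X \<sigma> s) \<le> 1"
proof -
  \<comment> \<open>The indicator of \<open>s\<close> as initial weight turns the superposition into
    the single run from \<open>s\<close>.\<close>
  have "0 \<le> (if s' = s then 1 else (0 :: real))" for s'
    by simp
  from scheduler_trace_flow[OF assms this] obtain v
    where "trace_flow X (\<lambda>\<alpha>. \<Sum>s'\<in>UNIV. (if s' = s then 1 else 0) *\<^sub>R reach \<sigma> s' \<alpha>) v"
    by (rule exE)
  then have flow: "trace_flow X (reach \<sigma> s) v"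
    by (simp add: if_distrib[of "\<lambda>x. x *\<^sub>R _"] cong: if_cong)
  show "(reach \<sigma> s has_sum outcome X \<sigma> s) (max_traces X)" "0 \<le> outcome X \<sigma> s $ t"
    "mass (outcome X \<sigma> s) \<le> 1"
    using trace_flow_total[OF assms(1) flow] by (simp_all add: outcome_def mass_point_dist)
qed

text \<open>Positivity of all weights is what makes the new scheduler terminate: a mass deficit from
  any single state would show in the weighted total.\<close>

lemma simulation_outcome:
  fixes X :: "('e, 's::finite) ipbes" and Y :: "('f, 's) ipbes"
  assumes X: "is_ipbes X" and Y: "is_ipbes Y" and "terminating Y"
    and sim: "t_simulation X Y f" and Nil: "[] \<in> max_traces X \<longrightarrow> weakly_maximal Y []"
    and \<sigma>: "\<sigma> \<in> sched1 X" and \<iota>: "\<And>s. 0 < \<iota> s"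
  shows "\<exists>\<tau>\<in>sched1 Y. (\<Sum>s\<in>UNIV. \<iota> s *\<^sub>R outcome Y \<tau> s) = (\<Sum>s\<in>UNIV. \<iota> s *\<^sub>R outcome X \<sigma> s)"
proof -
  define \<phi> where "\<phi> \<alpha> = (\<Sum>s\<in>UNIV. \<iota> s *\<^sub>R reach \<sigma> s \<alpha>)" for \<alpha>
  have sched: "scheduler X \<sigma>"
    using \<sigma> by (simp add: sched1_def)
  obtain v where flow: "trace_flow X \<phi> v"
    using scheduler_trace_flow[OF X sched, of \<iota>] \<iota> unfolding \<phi>_def by (auto intro: less_imp_le)
  \<comment> \<open>The last simulation clause covers non-empty maximal traces; the empty one is
    covered by the separate hypothesis.\<close>
  have wm: "weakly_maximal Y (f \<alpha>)" if "\<alpha> \<in> max_traces X" for \<alpha>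
    using that sim Nil by (cases \<alpha> rule: rev_cases) (auto simp: t_simulation_def)
  \<comment> \<open>If \<open>f \<alpha>\<close> is already maximal, it is continued by the empty
    list of events.\<close>
  have "\<exists>\<beta>. \<alpha> \<in> max_traces X \<longrightarrow>
      \<beta> \<in> max_traces Y \<and> (\<exists>es. \<beta> = f \<alpha> @ es \<and> (\<forall>e\<in>set es. skip \<sqsubseteq>\<^sub>H label Y e))" for \<alpha>
    using wm[of \<alpha>] unfolding weakly_maximal_def by (metis append_Nil2 empty_iff empty_set)
  then have "\<forall>\<alpha>. \<exists>\<beta>. \<alpha> \<in> max_traces X \<longrightarrow>
      \<beta> \<in> max_traces Y \<and> (\<exists>es. \<beta> = f \<alpha> @ es \<and> (\<forall>e\<in>set es. skip \<sqsubseteq>\<^sub>H label Y e))"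
    by (rule allI)
  from choice[OF this] obtain g where g: "\<forall>\<alpha>. \<alpha> \<in> max_traces X \<longrightarrow>
      g \<alpha> \<in> max_traces Y \<and> (\<exists>es. g \<alpha> = f \<alpha> @ es \<and> (\<forall>e\<in>set es. skip \<sqsubseteq>\<^sub>H label Y e))"
    by (rule exE)
  interpret simulated_flow X Y f g \<phi> v
    by unfold_locales (use Y flow sim g in auto)
  obtain \<tau>\<^sub>0 where "scheduler Y \<tau>\<^sub>0"
    using \<open>terminating Y\<close> by (auto simp: terminating_def sched1_def)
  moreover have "pushed_mass [] = (\<Sum>s\<in>UNIV. \<iota> s *\<^sub>R point_dist s)"
    by (simp add: pushed_mass_Nil \<phi>_def)
  ultimately obtain \<tau> where \<tau>: "scheduler Y \<tau>"
    and reach: "\<And>\<beta>. \<beta> \<in> traces Y \<Longrightarrow> (\<Sum>s\<in>UNIV. \<iota> s *\<^sub>R reach \<tau> s \<beta>) = pushed_mass \<beta>"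
    using trace_flow_scheduler[OF Y pushed_flow] by blast
  have "(\<phi> has_sum (\<Sum>s\<in>UNIV. \<iota> s *\<^sub>R outcome X \<sigma> s)) (max_traces X)"
    unfolding \<phi>_def using scheduler_outcome(1)[OF X sched] by (intro has_sum_finite_combination) auto
  then have 1: "(pushed_mass has_sum (\<Sum>s\<in>UNIV. \<iota> s *\<^sub>R outcome X \<sigma> s)) (max_traces Y)"
    by (rule pushed_mass_has_sum)
  have "((\<lambda>\<beta>. \<Sum>s\<in>UNIV. \<iota> s *\<^sub>R reach \<tau> s \<beta>) has_sum (\<Sum>s\<in>UNIV. \<iota> s *\<^sub>R outcome Y \<tau> s)) (max_traces Y)"
    using scheduler_outcome(1)[OF Y \<tau>] by (intro has_sum_finite_combination) auto
  then have 2: "(pushed_mass has_sum (\<Sum>s\<in>UNIV. \<iota> s *\<^sub>R outcome Y \<tau> s)) (max_traces Y)"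
    by (rule has_sum_cong[THEN iffD1, rotated]) (use reach max_traces_subset in auto)
  have eq: "(\<Sum>s\<in>UNIV. \<iota> s *\<^sub>R outcome Y \<tau> s) = (\<Sum>s\<in>UNIV. \<iota> s *\<^sub>R outcome X \<sigma> s)"
    using 2 1 by (rule has_sum_unique)
  have mass: "mass (\<Sum>s\<in>UNIV. \<iota> s *\<^sub>R d s) = (\<Sum>s\<in>UNIV. \<iota> s * mass (d s))" for d :: "'s \<Rightarrow> real ^ 's"
    by (simp add: sum_distrib_left) (rule sum.swap)
  have "mass (outcome X \<sigma> s) = 1" for s
    using \<sigma> by (simp add: sched1_def dists_def)
  \<comment> \<open>Equal weighted outcomes have equal mass, so the weighted deficits sum to 0; each
    is nonnegative, hence each vanishes.\<close>
  then have "(\<Sum>s\<in>UNIV. \<iota> s * (1 - mass (outcome Y \<tau> s))) = 0"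
    using mass[of "outcome Y \<tau>"] mass[of "outcome X \<sigma>"] eq
    by (simp add: right_diff_distrib sum_subtractf)
  then have "\<forall>s\<in>UNIV. \<iota> s * (1 - mass (outcome Y \<tau> s)) = 0"
    using \<iota> scheduler_outcome(3)[OF Y \<tau>]
    by (subst (asm) sum_nonneg_eq_0_iff) (auto simp: less_imp_le)
  then have "mass (outcome Y \<tau> s) = 1" for s
    using \<iota>[of s] by (metis UNIV_I eq_iff_diff_eq_0 less_irrefl mult_eq_0_iff)
  then have "\<tau> \<in> sched1 Y"
    using \<tau> scheduler_outcome(2)[OF Y \<tau>] by (simp add: sched1_def dists_def)
  with eq show ?thesis
    by blast
qed

lemma norm_dists_le: "\<mu> \<in> dists \<Longrightarrow> norm \<mu> \<le> 1"
  using norm_le_l1_cart[of \<mu>] by (simp add: dists_def)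

theorem theorem4p13:
  fixes \<E> :: "('e, 's::finite) ipbes" and \<F> :: "('f, 's) ipbes"
  assumes "is_ipbes \<E>" and "is_ipbes \<F>"
    and "feasible \<E>" and "feasible \<F>"
    and "terminating \<E>" and "terminating \<F>"
    and "[] \<in> max_traces \<E> \<longrightarrow> weakly_maximal \<F> []"
    and "\<E> \<sqsubseteq>\<^sub>s\<^sub>i\<^sub>m \<F>"
  shows "\<E> \<sqsubseteq> \<F>"
proof -
  obtain f where f: "t_simulation \<E> \<F> f"
    using assms(8) by (auto simp: sim_le_def)
  have "outcome \<E> \<sigma> s \<in> semantics \<F> s" if \<sigma>: "\<sigma> \<in> sched1 \<E>" for \<sigma> s
  proof -
    let ?x = "outcome \<E> \<sigma>" and ?N = "real CARD('s)"
    have "\<exists>\<tau>\<in>sched1 \<F>. dist (outcome \<F> \<tau> s) (?x s) < \<epsilon>" if "0 < \<epsilon>" for \<epsilon>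
    proof -
      \<comment> \<open>The error at \<open>s\<close> will be \<open>\<delta>\<close> times a sum of
        at most \<open>?N\<close> vectors of norm at most 2; the added 1 makes the estimate
        strict.\<close>
      define \<delta> where "\<delta> = \<epsilon> / (2 * ?N + 1)"
      have \<delta>: "0 < \<delta>"
        using that by (simp add: \<delta>_def add_pos_nonneg)
      define \<iota> where "\<iota> s' = (if s' = s then 1 else \<delta>)" for s'
      have "0 < \<iota> s'" for s'
        using \<delta> by (simp add: \<iota>_def)
      from simulation_outcome[OF assms(1,2,6) f assms(7) \<sigma> this]
      obtain \<tau> where \<tau>: "\<tau> \<in> sched1 \<F>"
        and eq: "(\<Sum>s\<in>UNIV. \<iota> s *\<^sub>R outcome \<F> \<tau> s) = (\<Sum>s\<in>UNIV. \<iota> s *\<^sub>R ?x s)"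
        by (rule bexE)
      let ?y = "outcome \<F> \<tau>" and ?U = "UNIV - {s}"
      have split: "(\<Sum>s\<in>UNIV. \<iota> s *\<^sub>R d s) = d s + \<delta> *\<^sub>R sum d ?U" for d :: "'s \<Rightarrow> real ^ 's"
      proof -
        have "(\<Sum>s\<in>UNIV. \<iota> s *\<^sub>R d s) = \<iota> s *\<^sub>R d s + (\<Sum>s\<in>?U. \<iota> s *\<^sub>R d s)"
          by (rule sum.remove) simp_all
        also have "(\<Sum>s\<in>?U. \<iota> s *\<^sub>R d s) = \<delta> *\<^sub>R sum d ?U"
          unfolding scaleR_sum_right by (rule sum.cong) (auto simp: \<iota>_def)
        finally show ?thesis
          by (simp add: \<iota>_def)
      qed
      \<comment> \<open>The weighted outcomes agree, so the discrepancy at \<open>s\<close> is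
        balanced by the \<open>\<delta>\<close>-scaled discrepancies at the other states.\<close>
      have diff: "?y s - ?x s = \<delta> *\<^sub>R (\<Sum>t\<in>?U. ?x t - ?y t)"
      proof -
        have "p - q = b - a" if "p + a = q + b" for p q a b :: "real ^ 's"
          using that by (simp add: algebra_simps)
        from this[OF eq[unfolded split]] show ?thesis
          by (simp only: sum_subtractf scaleR_diff_right)
      qed
      have "norm (?x t - ?y t) \<le> 2" for t
        using norm_triangle_ineq4[of "?x t" "?y t"] norm_dists_le[of "?x t"] norm_dists_le[of "?y t"]
          \<sigma> \<tau> unfolding sched1_def by fastforce
      then have "norm (\<Sum>t\<in>?U. ?x t - ?y t) \<le> real (card ?U) * 2"
        by (rule sum_norm_bound)
      moreover have "card ?U \<le> CARD('s)"
        by (rule card_mono) auto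
      ultimately have "norm (\<Sum>t\<in>?U. ?x t - ?y t) < 2 * ?N + 1"
        by linarith
      then have "\<delta> * norm (\<Sum>t\<in>?U. ?x t - ?y t) < \<delta> * (2 * ?N + 1)"
        using \<delta> by (rule mult_strict_left_mono)
      with diff have "dist (?y s) (?x s) < \<delta> * (2 * ?N + 1)"
        using \<delta> by (simp add: dist_norm)
      also have "\<delta> * (2 * ?N + 1) = \<epsilon>"
        using add_pos_nonneg[of 1 "2 * ?N"] by (simp add: \<delta>_def)
      finally show ?thesis
        using \<tau> by blast
    qed
    \<comment> \<open>The scheduler varies with \<open>\<epsilon>\<close>, so the outcome is
      obtained as a limit point and not as an outcome of one scheduler.\<close>
    then have "?x s \<in> closure ((\<lambda>\<tau>. outcome \<F> \<tau> s) ` sched1 \<F>)"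
      by (auto simp: closure_approachable)
    then show ?thesis
      unfolding semantics_def using closure_mono[OF hull_subset] by blast
  qed
  \<comment> \<open>The right-hand side is closed and convex, so it contains the closed convex hull
    of the outcomes that lie in it.\<close>
  then have "semantics \<E> s \<subseteq> semantics \<F> s" for s
    unfolding semantics_def[of \<E>]
    by (intro closure_minimal hull_minimal) (auto simp: semantics_def convex_closure)
  then show ?thesis
    by (simp add: ipbes_le_def prog_le_def)
qed

end
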